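(* Suppose $\lambda$ is a dominant cocharacter of $\mathrm{PGL}_n$ and $x_1,x_2\in\mathsf{C}_{ad}^\lambda\cap\mathrm{S}_n^{ad}(F)$. Then there exists $g\in\mathrm{PGL}_n(\mathcal{O}')$ such that $g^{-1}x_1\bar g=x_2$.
   Context: $n\ge1$; $\kappa$ is a finite field with $\mathrm{char}(\kappa)>2n$, $\mathcal{O}=\kappa[[\pi]]$, $F=\kappa((\pi))$; $\kappa'$ is either the quadratic field extension of $\kappa$ or $\kappa\times\kappa$; $\mathcal{O}'=\mathcal{O}\otimes_\kappa\kappa'$, $F'=F\otimes_\kappa\kappa'$, and bar denotes the automorphism induced by the non-trivial automorphism of $\kappa'/\kappa$. $\mathrm{S}_n^{ad}(F)=\{g\in\mathrm{PGL}_n(F'):g\bar g=1\}$, and $\mathsf{C}^\lambda_{ad}=\mathrm{PGL}_n(\mathcal{O}')\pi^\lambda\mathrm{PGL}_n(\mathcal{O}')\subset\mathrm{PGL}_n(F')$. When $\kappa'=\kappa\times\kappa$, $\lambda$ is understood as a pair $(\lambda_1,\lambda_2)$ of dominant cocharacters, one for each factor of $\mathrm{PGL}_n(F')=\mathrm{PGL}_n(F)\times\mathrm{PGL}_n(F)$. *)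

theory Defs
  imports
    "Jordan_Normal_Form.Matrix"
    "HOL-Algebra.Coset"
    "HOL-Computational_Algebra.Formal_Laurent_Series"
begin

definition GL :: "nat \<Rightarrow> 'a::comm_ring_1 mat monoid"
  where "GL n = units_of (ring_mat TYPE('a) n ())"

definition scalars :: "nat \<Rightarrow> 'a::comm_ring_1 mat set"
  where "scalars n = {c \<cdot>\<^sub>m 1\<^sub>m n | c. c dvd 1}"

text \<open>
  Over a ring with trivial Picard group, such as a field or a local ring, the points of the
  algebraic group \<open>PGL\<^sub>n\<close> are the classes of invertible matrices modulo unit scalars.
\<close>

definition PGL :: "nat \<Rightarrow> 'a::comm_ring_1 mat set monoid"
  where "PGL n = GL n Mod scalars n"

definition pgl_class :: "nat \<Rightarrow> 'a::comm_ring_1 mat \<Rightarrow> 'a mat set"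
  where "pgl_class n A = scalars n #>\<^bsub>GL n\<^esub> A"

text \<open>\<open>PGL\<^sub>n(k[[\<pi>]])\<close>, viewed inside \<open>PGL\<^sub>n(k((\<pi>)))\<close>.\<close>

definition PGL_int :: "nat \<Rightarrow> 'a::comm_ring_1 fls mat set set"
  where "PGL_int n = (\<lambda>B. pgl_class n (map_mat fps_to_fls B)) ` carrier (GL n)"

text \<open>
  The cocharacters of the diagonal torus of \<open>PGL\<^sub>n\<close> form the group of integer vectors
  \<open>(\<mu> 0, \<dots>, \<mu> (n - 1))\<close> modulo constant vectors. A cocharacter is given here by any of its
  representatives; neither dominance nor the class of \<open>diag (\<pi> ^ \<mu> i)\<close> depends on the choice
  (lemmas \<open>dominant_shift\<close> and \<open>pi_pow_shift\<close> below).
\<close>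

definition dominant :: "nat \<Rightarrow> (nat \<Rightarrow> int) \<Rightarrow> bool"
  where "dominant n \<mu> \<longleftrightarrow> (\<forall>i j. i \<le> j \<longrightarrow> j < n \<longrightarrow> \<mu> j \<le> \<mu> i)"

definition pi_pow :: "nat \<Rightarrow> (nat \<Rightarrow> int) \<Rightarrow> 'a::comm_ring_1 fls mat set"
  where "pi_pow n \<mu> = pgl_class n (mat_diag n (\<lambda>i. fls_X_intpow (\<mu> i)))"

text \<open>
  The next two definitions are applied with \<open>G\<close> the group \<open>PGL\<^sub>n(F')\<close>, \<open>K\<close> its subgroup
  \<open>PGL\<^sub>n(\<O>')\<close>, \<open>t\<close> the class of \<open>\<pi> ^ \<mu>\<close>, and \<open>\<theta>\<close> the automorphism of \<open>G\<close> written as a bar.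
\<close>

definition S_ad :: "('g, 'm) monoid_scheme \<Rightarrow> ('g \<Rightarrow> 'g) \<Rightarrow> 'g set"
  where "S_ad G \<theta> = {g \<in> carrier G. g \<otimes>\<^bsub>G\<^esub> \<theta> g = \<one>\<^bsub>G\<^esub>}"

definition C_ad :: "('g, 'm) monoid_scheme \<Rightarrow> 'g set \<Rightarrow> 'g \<Rightarrow> 'g set"
  where "C_ad G K t = K <#>\<^bsub>G\<^esub> {t} <#>\<^bsub>G\<^esub> K"

definition quadratic_extension :: "('k::field \<Rightarrow> 'l::field) \<Rightarrow> bool"
  where "quadratic_extension \<iota> \<longleftrightarrow>
    comm_ring_hom \<iota> \<and> vector_space.dim (\<lambda>a x. \<iota> a * x) UNIV = 2"

definition nontrivial_automorphism :: "('k::field \<Rightarrow> 'l::field) \<Rightarrow> ('l \<Rightarrow> 'l) \<Rightarrow> bool"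
  where "nontrivial_automorphism \<iota> \<sigma> \<longleftrightarrow>
    comm_ring_hom \<sigma> \<and> bij \<sigma> \<and> \<sigma> \<circ> \<iota> = \<iota> \<and> \<sigma> \<noteq> id"

text \<open>
  For a quadratic extension \<open>\<kappa>'\<close> of \<open>\<kappa>\<close>, the ring \<open>\<kappa>((\<pi>)) \<otimes> \<kappa>'\<close> is \<open>\<kappa>'((\<pi>))\<close>, with
  \<open>f \<otimes> b\<close> corresponding to \<open>fls_map \<iota> f * fls_const b\<close> (see \<open>laurent_base_change\<close> below). The
  automorphism \<open>id \<otimes> \<sigma>\<close> then acts on coefficients. In the same way \<open>\<kappa>[[\<pi>]] \<otimes> \<kappa>'\<close> is \<open>\<kappa>'[[\<pi>]]\<close>.
  For \<open>\<kappa>' = \<kappa> \<times> \<kappa>\<close> the group \<open>PGL\<^sub>n(F')\<close> is the direct product \<open>PGL n \<times>\<times> PGL n\<close> over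
  \<open>\<kappa>((\<pi>))\<close>, and the bar is \<open>prod.swap\<close>.
\<close>

definition fls_map :: "('a::zero \<Rightarrow> 'b::zero) \<Rightarrow> 'a fls \<Rightarrow> 'b fls"
  where "fls_map \<sigma> f = Abs_fls (\<lambda>k. \<sigma> (fls_nth f k))"

definition pgl_bar :: "('a::comm_ring_1 \<Rightarrow> 'a) \<Rightarrow> 'a fls mat set \<Rightarrow> 'a fls mat set"
  where "pgl_bar \<sigma> x = map_mat (fls_map \<sigma>) ` x"


lemma fls_nth_fls_map:
  assumes "\<sigma> 0 = 0"
  shows "fls_nth (fls_map \<sigma> f) k = \<sigma> (fls_nth f k)"
proof -
  have "\<forall>\<^sub>\<infinity>n::nat. fls_nth f (- int n) = 0"
    using fls_nth[of f] by simp
  then have "\<forall>\<^sub>\<infinity>n::nat. \<sigma> (fls_nth f (- int n)) = 0"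
    by eventually_elim (simp add: assms)
  then show ?thesis
    unfolding fls_map_def by (subst Abs_fls_inverse) auto
qed

lemma laurent_base_change:
  fixes \<iota> :: "'k::comm_ring_1 \<Rightarrow> 'l::comm_ring_1" and b1 b2 :: 'l and f :: "'l fls"
  assumes hom: "comm_ring_hom \<iota>"
    and basis: "\<And>x. \<exists>!p. x = \<iota> (fst p) * b1 + \<iota> (snd p) * b2"
  shows "\<exists>!p. f = fls_map \<iota> (fst p) * fls_const b1 + fls_map \<iota> (snd p) * fls_const b2"
proof -
  interpret comm_ring_hom \<iota> by (rule hom)
  have nth: "fls_nth (fls_map \<iota> g * fls_const b1 + fls_map \<iota> h * fls_const b2) k
      = \<iota> (fls_nth g k) * b1 + \<iota> (fls_nth h k) * b2" for g h :: "'k fls" and k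
    by (simp add: fls_nth_fls_map)
  define c where "c x = (THE p. x = \<iota> (fst p) * b1 + \<iota> (snd p) * b2)" for x
  have c: "x = \<iota> (fst (c x)) * b1 + \<iota> (snd (c x)) * b2" for x
    unfolding c_def by (rule theI'[OF basis])
  have cI: "c x = p" if "x = \<iota> (fst p) * b1 + \<iota> (snd p) * b2" for x p
    using basis[of x] c[of x] that by blast
  have c0: "c 0 = (0, 0)"
    by (rule cI) simp
  show ?thesis
  proof (rule ex1I)
    let ?p = "(fls_map (fst \<circ> c) f, fls_map (snd \<circ> c) f)"
    show "f = fls_map \<iota> (fst ?p) * fls_const b1 + fls_map \<iota> (snd ?p) * fls_const b2"
      by (rule fls_eqI) (simp only: nth fst_conv snd_conv, simp add: fls_nth_fls_map c0 c[symmetric])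
    fix p assume p: "f = fls_map \<iota> (fst p) * fls_const b1 + fls_map \<iota> (snd p) * fls_const b2"
    have "c (fls_nth f k) = (fls_nth (fst p) k, fls_nth (snd p) k)" for k
      by (rule cI) (subst p, simp only: nth fst_conv snd_conv)
    then show "p = ?p"
      by (auto simp: prod_eq_iff fls_eq_iff fls_nth_fls_map c0)
  qed
qed

lemma group_GL: "group (GL n :: 'a::comm_ring_1 mat monoid)"
proof -
  interpret ring "ring_mat TYPE('a) n ()" by (rule ring_mat)
  show ?thesis unfolding GL_def by (rule units_group)
qed

lemma carrier_GL_iff:
  "A \<in> carrier (GL n) \<longleftrightarrow>
    A \<in> carrier_mat n n \<and> (\<exists>B\<in>carrier_mat n n. B * A = 1\<^sub>m n \<and> A * B = 1\<^sub>m n)"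
  by (auto simp: GL_def units_of_def Units_def ring_mat_def)

lemma mult_GL [simp]: "A \<otimes>\<^bsub>GL n\<^esub> B = A * B"
  by (simp add: GL_def units_of_def ring_mat_def)

lemma one_GL [simp]: "\<one>\<^bsub>GL n\<^esub> = 1\<^sub>m n"
  by (simp add: GL_def units_of_def ring_mat_def)

lemma smult_one_mult:
  fixes A :: "'a::comm_ring_1 mat"
  assumes "A \<in> carrier_mat n n"
  shows "(c \<cdot>\<^sub>m 1\<^sub>m n) * A = c \<cdot>\<^sub>m A" "A * (c \<cdot>\<^sub>m 1\<^sub>m n) = c \<cdot>\<^sub>m A"
  using assms mult_smult_assoc_mat[of "1\<^sub>m n" n n A n c] mult_smult_distrib[of A n n "1\<^sub>m n" n c]
  by auto

lemma scalars_subset: "scalars n \<subseteq> carrier (GL n :: 'a::comm_ring_1 mat monoid)"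
proof
  fix A :: "'a mat" assume "A \<in> scalars n"
  then obtain c d where cd: "A = c \<cdot>\<^sub>m 1\<^sub>m n" "1 = c * d"
    by (auto simp: scalars_def dvd_def)
  have "(d \<cdot>\<^sub>m 1\<^sub>m n) * A = 1\<^sub>m n" "A * (d \<cdot>\<^sub>m 1\<^sub>m n) = 1\<^sub>m n"
    using cd by (auto simp: smult_one_mult mult.commute)
  with cd show "A \<in> carrier (GL n)"
    unfolding carrier_GL_iff by (intro conjI bexI[of _ "d \<cdot>\<^sub>m 1\<^sub>m n"]) auto
qed

lemma normal_scalars: "scalars n \<lhd> (GL n :: 'a::comm_ring_1 mat monoid)"
proof -
  interpret group "GL n :: 'a mat monoid" by (rule group_GL)
  have "subgroup (scalars n) (GL n :: 'a mat monoid)"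
  proof (rule subgroupI[OF scalars_subset])
    show "scalars n \<noteq> {}" by (auto simp: scalars_def intro: exI[of _ 1])
  next
    fix A :: "'a mat" assume A: "A \<in> scalars n"
    then obtain c d where cd: "A = c \<cdot>\<^sub>m 1\<^sub>m n" "1 = c * d"
      by (auto simp: scalars_def dvd_def)
    have d: "d \<cdot>\<^sub>m 1\<^sub>m n \<in> scalars n"
      using cd(2) dvd_triv_right[of d c] by (auto simp: scalars_def)
    have "inv\<^bsub>GL n\<^esub> A = d \<cdot>\<^sub>m 1\<^sub>m n"
      by (rule inv_equality) (use cd A d scalars_subset in \<open>auto simp: smult_one_mult mult.commute\<close>)
    with d show "inv\<^bsub>GL n\<^esub> A \<in> scalars n" by simp
  next
    fix A B :: "'a mat" assume "A \<in> scalars n" "B \<in> scalars n"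
    then obtain c d where "A = c \<cdot>\<^sub>m 1\<^sub>m n" "B = d \<cdot>\<^sub>m 1\<^sub>m n" "c dvd 1" "d dvd 1"
      by (auto simp: scalars_def)
    moreover from this have "c * d dvd 1"
      using mult_dvd_mono[of c 1 d 1] by simp
    ultimately show "A \<otimes>\<^bsub>GL n\<^esub> B \<in> scalars n"
      by (auto simp: scalars_def smult_one_mult intro!: exI[of _ "c * d"])
  qed
  then show ?thesis
  proof (rule normal_invI)
    fix x h :: "'a mat" assume x: "x \<in> carrier (GL n)" and h: "h \<in> scalars n"
    have "x \<otimes>\<^bsub>GL n\<^esub> h = h \<otimes>\<^bsub>GL n\<^esub> x"
      using x h by (auto simp: scalars_def carrier_GL_iff smult_one_mult)
    then have "x \<otimes>\<^bsub>GL n\<^esub> h \<otimes>\<^bsub>GL n\<^esub> inv\<^bsub>GL n\<^esub> x = h"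
      using x h scalars_subset by (metis inv_solve_right' m_closed subsetD)
    with h show "x \<otimes>\<^bsub>GL n\<^esub> h \<otimes>\<^bsub>GL n\<^esub> inv\<^bsub>GL n\<^esub> x \<in> scalars n" by simp
  qed
qed

lemma group_PGL: "group (PGL n :: 'a::comm_ring_1 mat set monoid)"
  unfolding PGL_def by (rule normal.factorgroup_is_group[OF normal_scalars])

lemma pgl_class_eq:
  fixes A :: "'a::comm_ring_1 mat"
  assumes "A \<in> carrier_mat n n"
  shows "pgl_class n A = {c \<cdot>\<^sub>m A | c. c dvd 1}"
  using smult_one_mult(1)[OF assms] by (force simp: pgl_class_def r_coset_def scalars_def)

lemma comm_ring_hom_fls_map:
  fixes \<sigma> :: "'a::comm_ring_1 \<Rightarrow> 'b::comm_ring_1"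
  assumes hom: "comm_ring_hom \<sigma>" and inj: "inj \<sigma>"
  shows "comm_ring_hom (fls_map \<sigma>)"
proof -
  interpret comm_ring_hom \<sigma> by (rule hom)
  have sub: "fls_subdegree (fls_map \<sigma> f) = fls_subdegree f" for f
  proof (cases "f = 0")
    case True
    then have "fls_map \<sigma> f = 0" by (auto simp: fls_eq_iff fls_nth_fls_map)
    with True show ?thesis by simp
  next
    case False
    then have "fls_nth f (fls_subdegree f) \<noteq> 0" by simp
    then have "\<sigma> (fls_nth f (fls_subdegree f)) \<noteq> 0"
      using inj by (metis hom_zero injD)
    then show ?thesis
      by (intro fls_subdegree_eqI) (simp_all add: fls_nth_fls_map)
  qed
  have mult: "fls_map \<sigma> (f * g) = fls_map \<sigma> f * fls_map \<sigma> g" for f g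
    by (simp add: fls_eq_iff fls_nth_fls_map fls_times_nth(1) sub hom_sum hom_mult)
  show ?thesis
    by standard (use mult in \<open>auto simp: fls_eq_iff fls_nth_fls_map hom_add\<close>)
qed

lemma pgl_bar_pgl_class:
  fixes \<sigma> :: "'a::comm_ring_1 \<Rightarrow> 'a"
  assumes hom: "comm_ring_hom \<sigma>" and bij: "bij \<sigma>" and A: "A \<in> carrier_mat n n"
  shows "pgl_bar \<sigma> (pgl_class n A) = pgl_class n (map_mat (fls_map \<sigma>) A)"
proof -
  let ?\<tau> = "inv_into UNIV \<sigma>"
  interpret s: comm_ring_hom \<sigma> by (rule hom)
  interpret h: comm_ring_hom "fls_map \<sigma>"
    by (rule comm_ring_hom_fls_map[OF hom bij_is_inj[OF bij]])
  have inv0: "?\<tau> 0 = 0"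
    by (rule inv_f_eq[OF bij_is_inj[OF bij]]) simp
  have inv: "fls_map \<sigma> (fls_map (?\<tau>) c) = c" for c
    by (auto simp: fls_eq_iff fls_nth_fls_map inv0 surj_f_inv_f[OF bij_is_surj[OF bij]])
  have inv': "comm_ring_hom (?\<tau>)"
    by standard (auto intro!: inv_f_eq[OF bij_is_inj[OF bij]]
      simp: s.hom_add s.hom_mult surj_f_inv_f[OF bij_is_surj[OF bij]])
  interpret i: comm_ring_hom "fls_map (?\<tau>)"
    by (rule comm_ring_hom_fls_map[OF inv' bij_is_inj[OF bij_imp_bij_inv[OF bij]]])
  have smult: "map_mat (fls_map \<sigma>) (c \<cdot>\<^sub>m A) = fls_map \<sigma> c \<cdot>\<^sub>m map_mat (fls_map \<sigma>) A" for c
    by (rule eq_matI) (auto simp: h.hom_mult)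
  have A': "map_mat (fls_map \<sigma>) A \<in> carrier_mat n n"
    using A by simp
  show ?thesis
    unfolding pgl_bar_def pgl_class_eq[OF A] pgl_class_eq[OF A']
  proof (intro equalityI subsetI; clarsimp)
    fix c :: "'a fls" assume "c dvd 1"
    then show "\<exists>d. map_mat (fls_map \<sigma>) (c \<cdot>\<^sub>m A) = d \<cdot>\<^sub>m map_mat (fls_map \<sigma>) A \<and> d dvd 1"
      using h.hom_dvd_1 smult by blast
  next
    fix c :: "'a fls" assume "c dvd 1"
    then have "fls_map (?\<tau>) c dvd 1" by (rule i.hom_dvd_1)
    then show "c \<cdot>\<^sub>m map_mat (fls_map \<sigma>) A \<in> map_mat (fls_map \<sigma>) ` {c \<cdot>\<^sub>m A |c. c dvd 1}"
      by (intro image_eqI[of _ _ "fls_map (?\<tau>) c \<cdot>\<^sub>m A"]) (auto simp: smult inv)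
  qed
qed

lemma dominant_shift: "dominant n (\<lambda>i. \<mu> i + m) = dominant n \<mu>"
  by (simp add: dominant_def)

lemma pi_pow_shift: "(pi_pow n (\<lambda>i. \<mu> i + m) :: 'a::comm_ring_1 fls mat set) = pi_pow n \<mu>"
proof -
  let ?D = "\<lambda>\<mu>. mat_diag n (\<lambda>i. fls_X_intpow (\<mu> i)) :: 'a fls mat"
  have X: "fls_X_intpow (a + b) = (fls_X_intpow a * fls_X_intpow b :: 'a fls)" for a b
    by (simp add: fls_X_intpow_times_fls_X_intpow)
  have u: "fls_X_intpow m * fls_X_intpow (- m) = (1 :: 'a fls)"
    by (subst X[symmetric]) simp
  have u': "fls_X_intpow (- m) * (fls_X_intpow m * x) = x" for x :: "'a fls"
    using u by (metis mult.assoc mult.commute mult.left_neutral)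
  have dvd: "(fls_X_intpow m :: 'a fls) dvd 1" "(fls_X_intpow (- m) :: 'a fls) dvd 1"
    using u by (metis dvd_triv_left, metis dvd_triv_right)
  have D: "?D (\<lambda>i. \<mu> i + m) = fls_X_intpow m \<cdot>\<^sub>m ?D \<mu>"
    unfolding X by (rule eq_matI) (auto simp: mat_diag_def mult.commute)
  have D': "?D \<mu> = fls_X_intpow (- m) \<cdot>\<^sub>m ?D (\<lambda>i. \<mu> i + m)"
    unfolding D by (rule eq_matI) (simp_all only: index_smult_mat u' dim_row_mat dim_col_mat)
  have C: "?D \<mu> \<in> carrier_mat n n" for \<mu>
    by (simp add: mat_diag_def)
  have dvdm: "c * e dvd 1" if "c dvd 1" "e dvd 1" for c e :: "'a fls"
    using mult_dvd_mono[OF that] by simp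
  have sub: "{c \<cdot>\<^sub>m (u \<cdot>\<^sub>m A) | c. c dvd 1} \<subseteq> {c \<cdot>\<^sub>m A | c. c dvd 1}"
    if "u dvd 1" for u and A :: "'a fls mat"
  proof
    fix B assume "B \<in> {c \<cdot>\<^sub>m (u \<cdot>\<^sub>m A) | c. c dvd 1}"
    then obtain c where c: "B = c \<cdot>\<^sub>m (u \<cdot>\<^sub>m A)" "c dvd 1" by blast
    have "B = (c * u) \<cdot>\<^sub>m A"
      unfolding c by (rule eq_matI) (auto simp: mult.assoc)
    then show "B \<in> {c \<cdot>\<^sub>m A | c. c dvd 1}"
      using dvdm[OF c(2) that] by blast
  qed
  show ?thesis
    unfolding pi_pow_def pgl_class_eq[OF C]
    using sub[OF dvd(1), of "?D \<mu>"] sub[OF dvd(2), of "?D (\<lambda>i. \<mu> i + m)"]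
    unfolding D[symmetric] D'[symmetric] by (rule equalityI)
qed

end

theory Submission
  imports Defs "Jordan_Normal_Form.Determinant"
begin

text \<open>
  In the field case write \<open>x = [A]\<close> with \<open>A * bar A = c\<close> scalar. Norms of units are surjective for the
  unramified extension, so after rescaling \<open>A\<close> has power series entries and \<open>A * bar A = \<pi> ^ d\<close>. The
  semilinear map \<open>\<phi> v = A * bar v\<close> then satisfies \<open>\<phi> \<circ> \<phi> = \<pi> ^ d\<close>. After dividing by powers of \<open>\<pi>\<close>,
  some \<open>v\<close> is independent of \<open>\<phi> v\<close> modulo \<open>\<pi>\<close>; their span has a \<open>\<phi>\<close>-stable complement, and
  induction brings \<open>A\<close> to the form \<open>diag (\<pi> ^ \<nu> i) * w\<close> with \<open>\<nu>\<close> dominant and \<open>w\<close> the reversal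
  permutation. Uniqueness in the Cartan decomposition forces \<open>\<nu>\<close> and \<open>\<mu>\<close> to differ by a constant,
  so all \<open>x\<close> are twisted conjugate to the same class. In the split case \<open>x = (a, inv a)\<close>, and the two
  components of \<open>g\<close> act independently on the left and right of \<open>a\<close>.
\<close>

section \<open>Twisted equivalence of matrices\<close>

text \<open>Solving \<open>A * bar g = g * B\<close> over the Laurent series field does not yield an
  integral \<open>g\<close>, so the argument follows the standard lattice and its reduction modulo
  \<pi>. There semilinearity is decisive: a linear map could be scalar modulo \<pi> and leave no
  vector independent of its image, whereas in rank at least two a nonzero reduction of \<phi> always
  has such a vector, because \<sigma> moves some scalar. Rank one with a unit entry is left over;
  there \<open>d = 0\<close> and Hilbert 90 applies. The plane spanned by \<open>v\<close> and
  \<open>\<phi> v\<close> contributes the exponents \<open>d\<close> and \<open>0\<close>, and all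
  exponents lie between these two. Placing the plane around the inner block therefore makes \<nu>
  dominant without any sorting, and this placement is why the normal form is antidiagonal. The bound
  on the characteristic gives \<open>2 \<noteq> 0\<close>, which serves to count squares in the
  finite residue field and to halve coefficients when norms are lifted to power series.\<close>

lemma GL_carrier_mat: "A \<in> carrier (GL n) \<Longrightarrow> A \<in> carrier_mat n n"
  by (simp add: carrier_GL_iff)

lemma GL_mult: "A \<in> carrier (GL n) \<Longrightarrow> B \<in> carrier (GL n) \<Longrightarrow> A * B \<in> carrier (GL n)"
  using group.subgroup_self[OF group_GL, of n] monoid.m_closed[OF group.is_monoid[OF group_GL], of A n B]
  by simp

lemma GL_iff_det:
  fixes A :: "'a::comm_ring_1 mat"
  assumes A: "A \<in> carrier_mat n n"
  shows "A \<in> carrier (GL n) \<longleftrightarrow> det A dvd 1"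
proof
  assume "A \<in> carrier (GL n)"
  then obtain B where B: "B \<in> carrier_mat n n" "A * B = 1\<^sub>m n"
    by (auto simp: carrier_GL_iff)
  have "det A * det B = 1"
    using det_mult[OF A B(1)] B(2) by simp
  then show "det A dvd 1" by (metis dvd_triv_left)
next
  assume "det A dvd 1"
  then obtain d where d: "1 = det A * d" by (auto simp: dvd_def)
  let ?B = "d \<cdot>\<^sub>m adj_mat A"
  have B: "?B \<in> carrier_mat n n" using adj_mat(1)[OF A] by simp
  have "A * ?B = 1\<^sub>m n"
    using mult_smult_distrib[OF A adj_mat(1)[OF A], of d] adj_mat(2)[OF A] d
    by (auto simp: mult.commute intro!: eq_matI)
  moreover have "?B * A = 1\<^sub>m n"
    using mult_smult_assoc_mat[OF adj_mat(1)[OF A] A, of d] adj_mat(3)[OF A] d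
    by (auto simp: mult.commute intro!: eq_matI)
  ultimately show "A \<in> carrier (GL n)"
    using A B by (auto simp: carrier_GL_iff)
qed

section \<open>Matrices bordered by one row and one column on each side\<close>

lemma index_mult_sum:
  assumes "A \<in> carrier_mat n k" "B \<in> carrier_mat k m" "i < n" "j < m"
  shows "(A * B) $$ (i, j) = (\<Sum>l<k. A $$ (i, l) * B $$ (l, j))"
  using assms by (auto simp: scalar_prod_def atLeast0LessThan intro!: sum.cong)

lemma sum_split_ends:
  fixes f :: "nat \<Rightarrow> 'a::comm_monoid_add"
  shows "(\<Sum>l<Suc (Suc m). f l) = f 0 + (\<Sum>l<m. f (Suc l)) + f (Suc m)"
  by (subst sum.lessThan_Suc, subst sum.lessThan_Suc_shift) simp

text \<open>The block matrix with rows \<open>(0, 0, p)\<close>, \<open>(0, C, 0)\<close>, \<open>(q, 0, 0)\<close>.\<close>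

definition antidiag_border :: "nat \<Rightarrow> 'a \<Rightarrow> 'a \<Rightarrow> 'a mat \<Rightarrow> 'a::zero mat"
  where "antidiag_border m p q C = mat (Suc (Suc m)) (Suc (Suc m)) (\<lambda>(i, j).
    if i = 0 then (if j = Suc m then p else 0)
    else if i = Suc m then (if j = 0 then q else 0)
    else if j = 0 \<or> j = Suc m then 0 else C $$ (i - 1, j - 1))"

text \<open>Extends a base change of the complement by the identity on the split-off plane.\<close>

definition diag_border :: "nat \<Rightarrow> 'a::{zero,one} mat \<Rightarrow> 'a mat"
  where "diag_border m C = mat (Suc (Suc m)) (Suc (Suc m)) (\<lambda>(i, j).
    if i = 0 \<or> i = Suc m \<or> j = 0 \<or> j = Suc m then (if i = j then 1 else 0)
    else C $$ (i - 1, j - 1))"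

lemma border_carrier [simp]:
  "antidiag_border m p q C \<in> carrier_mat (Suc (Suc m)) (Suc (Suc m))"
  "diag_border m C \<in> carrier_mat (Suc (Suc m)) (Suc (Suc m))"
  by (simp_all add: antidiag_border_def diag_border_def)

lemma border_cases:
  assumes "i < Suc (Suc m)"
  obtains "i = 0" | "i = Suc m" | k where "i = Suc k" "k < m"
  using assms by (cases i) (auto simp: less_Suc_eq)

lemma border_index:
  "i < Suc (Suc m) \<Longrightarrow> antidiag_border m p q C $$ (0, i) = (if i = Suc m then p else 0)"
  "i < Suc (Suc m) \<Longrightarrow> antidiag_border m p q C $$ (Suc m, i) = (if i = 0 then q else 0)"
  "k < m \<Longrightarrow> antidiag_border m p q C $$ (Suc k, 0) = 0"
  "k < m \<Longrightarrow> antidiag_border m p q C $$ (Suc k, Suc m) = 0"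
  "k < m \<Longrightarrow> l < m \<Longrightarrow> antidiag_border m p q C $$ (Suc k, Suc l) = C $$ (k, l)"
  "i < Suc (Suc m) \<Longrightarrow> diag_border m C $$ (0, i) = (if i = 0 then 1 else 0)"
  "i < Suc (Suc m) \<Longrightarrow> diag_border m C $$ (Suc m, i) = (if i = Suc m then 1 else 0)"
  "k < m \<Longrightarrow> diag_border m C $$ (Suc k, 0) = 0"
  "k < m \<Longrightarrow> diag_border m C $$ (Suc k, Suc m) = 0"
  "k < m \<Longrightarrow> l < m \<Longrightarrow> diag_border m C $$ (Suc k, Suc l) = C $$ (k, l)"
  by (auto simp: antidiag_border_def diag_border_def)

lemma border_mult:
  fixes C D :: "'a::comm_ring_1 mat"
  assumes C: "C \<in> carrier_mat m m" and D: "D \<in> carrier_mat m m"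
  shows "diag_border m C * diag_border m D = diag_border m (C * D)"
    and "diag_border m C * antidiag_border m p q D = antidiag_border m p q (C * D)"
    and "antidiag_border m p q C * diag_border m D = antidiag_border m p q (C * D)"
proof -
  note idx = index_mult_sum[OF border_carrier(2) border_carrier(2)]
    index_mult_sum[OF border_carrier(2) border_carrier(1)]
    index_mult_sum[OF border_carrier(1) border_carrier(2)]
  note s = index_mult_sum[OF C D] sum_split_ends border_index
  show "diag_border m C * diag_border m D = diag_border m (C * D)" (is "?L = ?R")
  proof (rule eq_matI)
    fix i j assume "i < dim_row ?R" "j < dim_col ?R"
    then have ij: "i < Suc (Suc m)" "j < Suc (Suc m)" by (simp_all add: diag_border_def)
    show "?L $$ (i, j) = ?R $$ (i, j)"
      unfolding idx(1)[OF ij]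
      by (rule border_cases[OF ij(1)]; rule border_cases[OF ij(2)]) (simp_all add: s del: sum.lessThan_Suc)
  qed (simp_all add: diag_border_def)
  show "diag_border m C * antidiag_border m p q D = antidiag_border m p q (C * D)" (is "?L = ?R")
  proof (rule eq_matI)
    fix i j assume "i < dim_row ?R" "j < dim_col ?R"
    then have ij: "i < Suc (Suc m)" "j < Suc (Suc m)" by (simp_all add: antidiag_border_def)
    show "?L $$ (i, j) = ?R $$ (i, j)"
      unfolding idx(2)[OF ij]
      by (rule border_cases[OF ij(1)]; rule border_cases[OF ij(2)]) (simp_all add: s del: sum.lessThan_Suc)
  qed (simp_all add: diag_border_def antidiag_border_def)
  show "antidiag_border m p q C * diag_border m D = antidiag_border m p q (C * D)" (is "?L = ?R")
  proof (rule eq_matI)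
    fix i j assume "i < dim_row ?R" "j < dim_col ?R"
    then have ij: "i < Suc (Suc m)" "j < Suc (Suc m)" by (simp_all add: antidiag_border_def)
    show "?L $$ (i, j) = ?R $$ (i, j)"
      unfolding idx(3)[OF ij]
      by (rule border_cases[OF ij(1)]; rule border_cases[OF ij(2)]) (simp_all add: s del: sum.lessThan_Suc)
  qed (simp_all add: diag_border_def antidiag_border_def)
qed

lemma diag_border_one: "diag_border m (1\<^sub>m m) = (1\<^sub>m (Suc (Suc m)) :: 'a::comm_ring_1 mat)" (is "?L = ?R")
proof (rule eq_matI)
  fix i j assume "i < dim_row ?R" "j < dim_col ?R"
  then have ij: "i < Suc (Suc m)" "j < Suc (Suc m)" by simp_all
  show "?L $$ (i, j) = ?R $$ (i, j)"
    by (rule border_cases[OF ij(1)]; rule border_cases[OF ij(2)]) (simp_all add: border_index)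
qed (simp_all add: diag_border_def)

lemma diag_border_GL:
  fixes g :: "'a::comm_ring_1 mat"
  assumes "g \<in> carrier (GL m)"
  shows "diag_border m g \<in> carrier (GL (Suc (Suc m)))"
proof -
  obtain h where h: "h \<in> carrier_mat m m" "h * g = 1\<^sub>m m" "g * h = 1\<^sub>m m" and g: "g \<in> carrier_mat m m"
    using assms by (auto simp: carrier_GL_iff)
  show ?thesis
    unfolding carrier_GL_iff
    using border_mult(1)[OF g h(1)] border_mult(1)[OF h(1) g] h
    by (intro conjI bexI[of _ "diag_border m h"]) (simp_all add: diag_border_one)
qed

section \<open>Semilinear base change over a ring with involution\<close>

locale ring_involution = comm_ring_hom bar for bar :: "'a::comm_ring_1 \<Rightarrow> 'a" +
  assumes bar_bar [simp]: "bar (bar x) = x"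
begin

abbreviation conj_mat :: "'a mat \<Rightarrow> 'a mat"
  where "conj_mat \<equiv> map_mat bar"

text \<open>Base change for the semilinear map \<open>x \<mapsto> A * bar x\<close>: its matrix in
  the basis formed by the columns of \<open>g\<close> is \<open>B\<close>. Written without the
  inverse of \<open>g\<close>, the relation can be checked entrywise over any ring.\<close>

definition tweq :: "nat \<Rightarrow> 'a mat \<Rightarrow> 'a mat \<Rightarrow> bool"
  where "tweq n A B \<longleftrightarrow> (\<exists>g\<in>carrier (GL n). A * conj_mat g = g * B)"

lemma conj_conj [simp]: "conj_mat (conj_mat A) = A"
  by (rule eq_matI) auto

lemma conj_mat_GL: "g \<in> carrier (GL n) \<Longrightarrow> conj_mat g \<in> carrier (GL n)"
  unfolding carrier_GL_iff
  by (metis map_carrier_mat mat_hom_mult mat_hom_one)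

lemma tweq_trans:
  assumes "tweq n A B" "tweq n B C"
    and A: "A \<in> carrier_mat n n" and B: "B \<in> carrier_mat n n" and C: "C \<in> carrier_mat n n"
  shows "tweq n A C"
proof -
  obtain g h where g: "g \<in> carrier (GL n)" "A * conj_mat g = g * B"
    and h: "h \<in> carrier (GL n)" "B * conj_mat h = h * C"
    using assms(1,2) by (auto simp: tweq_def)
  note gc = GL_carrier_mat[OF g(1)] and hc = GL_carrier_mat[OF h(1)]
  have "A * conj_mat (g * h) = A * conj_mat g * conj_mat h"
    using A gc hc by (simp add: mat_hom_mult[OF gc hc])
  also have "\<dots> = g * (B * conj_mat h)"
    unfolding g(2) using gc hc B by simp
  also have "\<dots> = (g * h) * C"
    unfolding h(2) using gc hc C by simp
  finally show ?thesis
    using GL_mult[OF g(1) h(1)] by (auto simp: tweq_def)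
qed

text \<open>Passing from \<open>A\<close> to \<open>B\<close> conjugates the linear map
  \<open>A * conj_mat A\<close> by \<open>g\<close>, and conjugation leaves a scalar matrix
  unchanged.\<close>

lemma tweq_square:
  assumes "tweq n A B" and A: "A \<in> carrier_mat n n" and B: "B \<in> carrier_mat n n"
    and sq: "A * conj_mat A = c \<cdot>\<^sub>m 1\<^sub>m n"
  shows "B * conj_mat B = c \<cdot>\<^sub>m 1\<^sub>m n"
proof -
  obtain g where g: "g \<in> carrier (GL n)" "A * conj_mat g = g * B"
    using assms(1) by (auto simp: tweq_def)
  note gc = GL_carrier_mat[OF g(1)]
  obtain h where h: "h \<in> carrier_mat n n" "h * g = 1\<^sub>m n"
    using g(1) by (auto simp: carrier_GL_iff)
  have "g * (B * conj_mat B) = A * conj_mat g * conj_mat B"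
    unfolding g(2) using gc B by simp
  also have "\<dots> = A * conj_mat (g * B)"
    using A B gc by (simp add: mat_hom_mult[OF gc B])
  also have "\<dots> = A * (conj_mat A * g)"
    unfolding g(2)[symmetric] using A gc by (simp add: mat_hom_mult[of A n n _ n])
  also have "\<dots> = (A * conj_mat A) * g"
    using A gc by simp
  also have "\<dots> = g * (c \<cdot>\<^sub>m 1\<^sub>m n)"
    unfolding sq using smult_one_mult[OF gc] by simp
  finally have "h * (g * (B * conj_mat B)) = h * (g * (c \<cdot>\<^sub>m 1\<^sub>m n))" by simp
  moreover have "h * (g * M) = M" if "M \<in> carrier_mat n n" for M
    using assoc_mult_mat[OF h(1) gc that] h(2) that by simp
  ultimately show ?thesis using B by simp
qed

lemma tweq_diag_border:
  assumes "tweq m C D" and C: "C \<in> carrier_mat m m" and D: "D \<in> carrier_mat m m"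
  shows "tweq (Suc (Suc m)) (antidiag_border m p q C) (antidiag_border m p q D)"
proof -
  obtain g where g: "g \<in> carrier (GL m)" "C * conj_mat g = g * D"
    using assms(1) by (auto simp: tweq_def)
  note gc = GL_carrier_mat[OF g(1)]
  have conj: "conj_mat (diag_border m g) = diag_border m (conj_mat g)" (is "?L = ?R")
  proof (rule eq_matI)
    fix i j assume "i < dim_row ?R" "j < dim_col ?R"
    then have ij: "i < Suc (Suc m)" "j < Suc (Suc m)" by (simp_all add: diag_border_def)
    have "?L $$ (i, j) = bar (diag_border m g $$ (i, j))"
      using ij by (simp add: diag_border_def)
    also have "\<dots> = ?R $$ (i, j)"
      using gc
      by (rule_tac border_cases[OF ij(1)]; rule_tac border_cases[OF ij(2)]) (simp_all add: border_index)
    finally show "?L $$ (i, j) = ?R $$ (i, j)" .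
  qed (simp_all add: diag_border_def)
  show ?thesis
    unfolding tweq_def
    by (rule bexI[OF _ diag_border_GL[OF g(1)]])
      (use gc C D g(2) in \<open>simp add: conj border_mult(2,3)\<close>)
qed

text \<open>Permutation matrices are fixed by \<open>bar\<close>, so twisted conjugation by one just
  renumbers the basis.\<close>

lemma tweq_permute:
  assumes B: "B \<in> carrier_mat n n" and \<tau>: "bij_betw \<tau> {..<n} {..<n}"
  shows "tweq n B (mat n n (\<lambda>(a, b). B $$ (\<tau> a, \<tau> b)))"
proof -
  let ?g = "mat n n (\<lambda>(a, b). if a = \<tau> b then 1 else 0) :: 'a mat"
  let ?h = "mat n n (\<lambda>(a, b). if b = \<tau> a then 1 else 0) :: 'a mat"
  let ?B = "mat n n (\<lambda>(a, b). B $$ (\<tau> a, \<tau> b))"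
  have in_n: "\<tau> b < n" if "b < n" for b using \<tau> that by (auto simp: bij_betw_def)
  have eq: "\<tau> a = \<tau> b \<longleftrightarrow> a = b" if "a < n" "b < n" for a b
    using \<tau> that by (auto simp: bij_betw_def inj_on_def)
  have preim: "\<exists>c<n. a = \<tau> c" if "a < n" for a
    using \<tau> that by (auto simp: bij_betw_def)
  have left: "(?g * M) $$ (\<tau> a, b) = M $$ (a, b)"
    if "M \<in> carrier_mat n n" "a < n" "b < n" for M a b
  proof -
    have "(?g * M) $$ (\<tau> a, b) = (\<Sum>l<n. (if l = a then M $$ (l, b) else 0))"
      unfolding index_mult_sum[OF _ that(1) in_n[OF that(2)] that(3), of ?g, simplified]
      by (rule sum.cong) (use that in \<open>auto simp: in_n eq\<close>)
    then show ?thesis using that by simp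
  qed
  have "?g * ?h = 1\<^sub>m n"
  proof (rule eq_matI)
    fix i j assume "i < dim_row (1\<^sub>m n :: 'a mat)" "j < dim_col (1\<^sub>m n :: 'a mat)"
    then have ij: "i < n" "j < n" by auto
    then obtain c where c: "c < n" "i = \<tau> c" using preim by blast
    show "(?g * ?h) $$ (i, j) = 1\<^sub>m n $$ (i, j)"
      using left[of ?h c j] c ij by auto
  qed auto
  moreover have "?h * ?g = 1\<^sub>m n"
  proof (rule eq_matI)
    fix i j assume "i < dim_row (1\<^sub>m n :: 'a mat)" "j < dim_col (1\<^sub>m n :: 'a mat)"
    then have ij: "i < n" "j < n" by auto
    have "(?h * ?g) $$ (i, j) = (\<Sum>l<n. (if l = \<tau> i then ?g $$ (l, j) else 0))"
      using ij by (subst index_mult_sum[where k = n and n = n and m = n]) (auto simp del: sum.delta sum.delta' intro!: sum.cong)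
    then show "(?h * ?g) $$ (i, j) = 1\<^sub>m n $$ (i, j)"
      using ij in_n[of i] eq[of i j] by simp
  qed auto
  ultimately have g: "?g \<in> carrier (GL n)"
    unfolding carrier_GL_iff by (intro conjI bexI[of _ ?h]) auto
  have "B * conj_mat ?g = ?g * ?B"
  proof (rule eq_matI)
    fix i j assume "i < dim_row (?g * ?B)" "j < dim_col (?g * ?B)"
    then have ij: "i < n" "j < n" by auto
    then obtain c where c: "c < n" "i = \<tau> c" using preim by blast
    have "(B * conj_mat ?g) $$ (i, j) = (\<Sum>l<n. (if l = \<tau> j then B $$ (i, l) else 0))"
      using ij B by (subst index_mult_sum[where k = n and n = n and m = n]) (auto simp del: sum.delta sum.delta' intro!: sum.cong)
    then have "(B * conj_mat ?g) $$ (i, j) = B $$ (i, \<tau> j)"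
      using ij in_n[of j] by simp
    then show "(B * conj_mat ?g) $$ (i, j) = (?g * ?B) $$ (i, j)"
      using left[of ?B c j] c ij by auto
  qed (use B in auto)
  with g show ?thesis by (auto simp: tweq_def)
qed

end

lemma prod_diag_ends:
  fixes A :: "'a::comm_ring_1 mat"
  assumes A: "A \<in> carrier_mat (Suc (Suc m)) (Suc (Suc m))" and ut: "upper_triangular A"
    and one: "\<And>i. i < Suc m \<Longrightarrow> A $$ (i, i) = 1"
  shows "det A = A $$ (Suc m, Suc m)"
proof -
  have "det A = (\<Prod>i=0..<Suc (Suc m). A $$ (i, i))"
    using det_upper_triangular[OF ut A] A by (simp only: prod_list_diag_prod carrier_matD)
  also have "\<dots> = (\<Prod>i=0..<Suc m. A $$ (i, i)) * A $$ (Suc m, Suc m)"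
    by (rule prod.atLeast0_lessThan_Suc)
  also have "(\<Prod>i=0..<Suc m. A $$ (i, i)) = 1"
    by (rule prod.neutral) (use one in auto)
  finally show ?thesis by simp
qed

section \<open>Splitting off a plane stable under the semilinear map\<close>

context ring_involution
begin

lemma tweq_by_inverse:
  assumes "g \<in> carrier_mat n n" "h \<in> carrier_mat n n" "g * h = 1\<^sub>m n" "h * g = 1\<^sub>m n"
    and B: "B \<in> carrier_mat n n"
  shows "tweq n B (h * (B * conj_mat g))"
proof -
  have "g * (h * (B * conj_mat g)) = (g * h) * (B * conj_mat g)"
    by (rule assoc_mult_mat[symmetric]) (use assms in auto)
  then have "B * conj_mat g = g * (h * (B * conj_mat g))"
    using assms by simp
  moreover have "g \<in> carrier (GL n)"
    unfolding carrier_GL_iff using assms by blast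
  ultimately show ?thesis unfolding tweq_def by blast
qed

text \<open>The base change replaces \<open>e\<^sub>0\<close> by \<open>v = e\<^sub>0 + c e\<close>,
  with \<open>e\<close> the last basis vector. The new corner is the last coordinate of
  \<open>\<phi> v\<close> in the new basis, whence the subtraction of \<open>c\<close> times the
  first coordinate. The parameter \<open>c\<close> is chosen later to make the corner a
  unit.\<close>

lemma tweq_elementary:
  assumes B: "B \<in> carrier_mat (Suc (Suc m)) (Suc (Suc m))"
  obtains B' where "B' \<in> carrier_mat (Suc (Suc m)) (Suc (Suc m))" "tweq (Suc (Suc m)) B B'"
    "B' $$ (Suc m, 0) = B $$ (Suc m, 0) + B $$ (Suc m, Suc m) * bar c
       - c * (B $$ (0, 0) + B $$ (0, Suc m) * bar c)"
proof -
  define n where "n = Suc (Suc m)"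
  define E where "E c = mat n n (\<lambda>(i, j). if i = j then 1 else if i = Suc m \<and> j = 0 then c else 0)"
    for c :: 'a
  have E [simp]: "E c \<in> carrier_mat n n" for c by (simp add: E_def)
  have row: "(E c * M) $$ (i, j) = M $$ (i, j) + (if i = Suc m then c * M $$ (0, j) else 0)"
    if "M \<in> carrier_mat n n" "i < n" "j < n" for c M i j
  proof -
    have "(E c * M) $$ (i, j) = (\<Sum>l<n. E c $$ (i, l) * M $$ (l, j))"
      by (rule index_mult_sum) (use that in auto)
    also have "\<dots> = (\<Sum>l<n. (if l = i then M $$ (l, j) else 0)
        + (if l = 0 then (if i = Suc m then c * M $$ (l, j) else 0) else 0))"
      by (rule sum.cong) (use that in \<open>auto simp: E_def n_def\<close>)
    finally show ?thesis
      using that by (simp add: sum.distrib sum.delta del: sum.lessThan_Suc)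
  qed
  have inv: "E c * E d = 1\<^sub>m n" if "c + d = 0" for c d
  proof (rule eq_matI)
    fix i j assume "i < dim_row (1\<^sub>m n :: 'a mat)" "j < dim_col (1\<^sub>m n :: 'a mat)"
    then have "i < n" "j < n" by auto
    then show "(E c * E d) $$ (i, j) = 1\<^sub>m n $$ (i, j)"
      using that by (simp only: row[OF E]) (auto simp: E_def n_def add.commute)
  qed (simp_all add: E_def)
  have B: "B \<in> carrier_mat n n" using assms by (simp add: n_def)
  have n0: "0 < n" by (simp add: n_def)
  let ?M = "B * conj_mat (E c)"
  have M: "?M \<in> carrier_mat n n" using B by simp
  have col0: "?M $$ (i, 0) = B $$ (i, 0) + B $$ (i, Suc m) * bar c" if "i < n" for i
  proof -
    have "?M $$ (i, 0) = (\<Sum>l<n. B $$ (i, l) * conj_mat (E c) $$ (l, 0))"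
      by (rule index_mult_sum[where m = n]) (use B that E[of c] n0 in auto)
    also have "\<dots> = (\<Sum>l<n. (if l = 0 then B $$ (i, l) else 0)
        + (if l = Suc m then B $$ (i, l) * bar c else 0))"
      by (rule sum.cong) (auto simp: E_def n_def)
    finally show ?thesis
      by (simp add: sum.distrib n_def del: sum.lessThan_Suc)
  qed
  show ?thesis
  proof (rule that)
    show "E (- c) * ?M \<in> carrier_mat (Suc (Suc m)) (Suc (Suc m))"
      using M E[of "- c"] by (auto simp: n_def)
    show "tweq (Suc (Suc m)) B (E (- c) * ?M)"
      using tweq_by_inverse[OF E E inv inv B, of c "- c"] by (simp add: n_def)
    show "(E (- c) * ?M) $$ (Suc m, 0) = B $$ (Suc m, 0) + B $$ (Suc m, Suc m) * bar c
       - c * (B $$ (0, 0) + B $$ (0, Suc m) * bar c)"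
      using row[OF M, of "Suc m" 0 "- c"] by (simp only: col0 n_def) (simp add: n_def)
  qed
qed

text \<open>
  Read \<open>B\<close> as the semilinear map \<open>\<phi> x = B * bar x\<close>, so that \<open>\<phi> (\<phi> x) = c x\<close>, and let \<open>w = \<phi> e\<^sub>0\<close>. The
  span of \<open>e\<^sub>0\<close> and \<open>w\<close> is \<open>\<phi>\<close>-stable; the last column of the base change is \<open>w\<close>.
\<close>

lemma tweq_normalize_columns:
  assumes B: "B \<in> carrier_mat (Suc (Suc m)) (Suc (Suc m))"
    and sq: "B * conj_mat B = c \<cdot>\<^sub>m 1\<^sub>m (Suc (Suc m))"
    and unit: "B $$ (Suc m, 0) dvd 1"
  obtains B' where "B' \<in> carrier_mat (Suc (Suc m)) (Suc (Suc m))" "tweq (Suc (Suc m)) B B'"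
    "\<And>i. i < Suc (Suc m) \<Longrightarrow> B' $$ (i, 0) = (if i = Suc m then 1 else 0)"
    "\<And>i. i < Suc (Suc m) \<Longrightarrow> B' $$ (i, Suc m) = (if i = 0 then c else 0)"
proof -
  define n where "n = Suc (Suc m)"
  note B = B[folded n_def] and sq = sq[folded n_def]
  have n: "0 < n" "Suc m < n" by (simp_all add: n_def)
  define P where "P = mat n n (\<lambda>(i, j). if j = Suc m then B $$ (i, 0) else if i = j then 1 else 0)"
  have P: "P \<in> carrier_mat n n" by (simp add: P_def)
  \<comment> \<open>\<open>P\<close> is upper triangular, so its determinant is the last coordinate
    of \<open>w\<close>. This is a unit, hence \<open>w\<close> may replace the last basis
    vector.\<close>
  have "det P = P $$ (Suc m, Suc m)"
    by (rule prod_diag_ends) (auto simp: P_def n_def intro!: upper_triangularI)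
  then have "P \<in> carrier (GL n)"
    unfolding GL_iff_det[OF P] using unit by (simp add: P_def n_def)
  then obtain h where h: "h \<in> carrier_mat n n" "h * P = 1\<^sub>m n" "P * h = 1\<^sub>m n"
    by (auto simp: carrier_GL_iff)
  let ?Q = "B * conj_mat P"
  have Q: "?Q \<in> carrier_mat n n" using B P by simp
  \<comment> \<open>As \<open>h\<close> inverts \<open>P\<close>, a column of \<open>M\<close> that
    is \<open>x\<close> times column \<open>k\<close> of \<open>P\<close> becomes \<open>x\<close>
    times the \<open>k\<close>-th unit vector.\<close>
  have col: "(h * M) $$ (i, j) = x * 1\<^sub>m n $$ (i, k)"
    if "M \<in> carrier_mat n n" "i < n" "j < n" "k < n" "\<And>l. l < n \<Longrightarrow> M $$ (l, j) = x * P $$ (l, k)"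
    for M i j k x
  proof -
    have "(h * M) $$ (i, j) = (\<Sum>l<n. h $$ (i, l) * M $$ (l, j))"
      by (rule index_mult_sum) (use h that in auto)
    also have "\<dots> = x * (\<Sum>l<n. h $$ (i, l) * P $$ (l, k))"
      unfolding sum_distrib_left by (rule sum.cong) (auto simp: that(5) ac_simps)
    also have "\<dots> = x * (h * P) $$ (i, k)"
      using index_mult_sum[OF h(1) P that(2,4)] by simp
    finally show ?thesis by (simp add: h(2))
  qed
  have Q0: "?Q $$ (l, 0) = 1 * P $$ (l, Suc m)" if "l < n" for l
  proof -
    have "?Q $$ (l, 0) = (\<Sum>k<n. B $$ (l, k) * conj_mat P $$ (k, 0))"
      by (rule index_mult_sum) (use B P that n in auto)
    also have "\<dots> = (\<Sum>k<n. if k = 0 then B $$ (l, k) else 0)"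
      by (rule sum.cong) (use n in \<open>auto simp: P_def\<close>)
    finally show ?thesis using that n by (simp add: P_def)
  qed
  \<comment> \<open>This column is \<open>\<phi> w = \<phi> (\<phi> e\<^sub>0)\<close>, which
    \<open>sq\<close> evaluates to \<open>c\<close> times \<open>e\<^sub>0\<close>.\<close>
  have Ql: "?Q $$ (l, Suc m) = c * P $$ (l, 0)" if "l < n" for l
  proof -
    have "?Q $$ (l, Suc m) = (\<Sum>k<n. B $$ (l, k) * conj_mat P $$ (k, Suc m))"
      by (rule index_mult_sum) (use B P that n in auto)
    also have "\<dots> = (\<Sum>k<n. B $$ (l, k) * conj_mat B $$ (k, 0))"
      by (rule sum.cong) (use B n in \<open>auto simp: P_def\<close>)
    also have "\<dots> = (B * conj_mat B) $$ (l, 0)"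
      by (rule index_mult_sum[symmetric]) (use B that n in auto)
    finally show ?thesis using that n by (simp add: sq P_def)
  qed
  show ?thesis
  proof (rule that)
    show "h * ?Q \<in> carrier_mat (Suc (Suc m)) (Suc (Suc m))" using h Q by (auto simp: n_def)
    show "tweq (Suc (Suc m)) B (h * ?Q)"
      using tweq_by_inverse[OF P h(1) h(3) h(2) B] by (simp add: n_def)
    fix i assume "i < Suc (Suc m)"
    then have i: "i < n" by (simp add: n_def)
    show "(h * ?Q) $$ (i, 0) = (if i = Suc m then 1 else 0)"
      using col[OF Q i n Q0] i n by auto
    show "(h * ?Q) $$ (i, Suc m) = (if i = 0 then c else 0)"
      using col[OF Q i n(2,1) Ql] i n by auto
  qed
qed

text \<open>
  Here \<open>\<phi>\<close> swaps \<open>e\<^sub>0\<close> and the last basis vector up to \<open>c\<close>. The \<open>\<phi>\<close>-equivariant projection onto their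
  span with last coordinate \<open>x \<mapsto> x\<^sub>l\<close> has first coordinate \<open>x \<mapsto> bar ((\<phi> x)\<^sub>l)\<close>; its kernel is a
  stable complement.
\<close>

lemma tweq_split_block:
  assumes B: "B \<in> carrier_mat (Suc (Suc m)) (Suc (Suc m))"
    and sq: "B * conj_mat B = c \<cdot>\<^sub>m 1\<^sub>m (Suc (Suc m))"
    and col0: "\<And>i. i < Suc (Suc m) \<Longrightarrow> B $$ (i, 0) = (if i = Suc m then 1 else 0)"
    and coll: "\<And>i. i < Suc (Suc m) \<Longrightarrow> B $$ (i, Suc m) = (if i = 0 then c else 0)"
  obtains C where "C \<in> carrier_mat m m" "C * conj_mat C = c \<cdot>\<^sub>m 1\<^sub>m m"
    "tweq (Suc (Suc m)) B (antidiag_border m c 1 C)"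
proof -
  let ?n = "Suc (Suc m)"
  define C where "C = mat m m (\<lambda>(i, j). B $$ (Suc i, Suc j))"
  have C: "C \<in> carrier_mat m m" by (simp add: C_def)
  let ?s = "\<lambda>k. B $$ (Suc m, Suc k)"
  have cB: "conj_mat B \<in> carrier_mat ?n ?n" using B by simp
  have cBi: "conj_mat B $$ (i, j) = bar (B $$ (i, j))" if "i < ?n" "j < ?n" for i j
    using B that by simp
  have sqi: "B $$ (i, 0) * bar (B $$ (0, Suc j)) + (\<Sum>k<m. B $$ (i, Suc k) * bar (C $$ (k, j)))
      + B $$ (i, Suc m) * bar (B $$ (Suc m, Suc j)) = (if i = Suc j then c else 0)"
    if "i < ?n" "j < m" for i j
  proof -
    have "(B * conj_mat B) $$ (i, Suc j) = B $$ (i, 0) * bar (B $$ (0, Suc j))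
        + (\<Sum>k<m. B $$ (i, Suc k) * bar (C $$ (k, j))) + B $$ (i, Suc m) * bar (B $$ (Suc m, Suc j))"
      using that index_mult_sum[OF B cB, of i "Suc j"]
      by (simp add: sum_split_ends cBi C_def del: sum.lessThan_Suc index_mult_mat index_map_mat)
    then show ?thesis
      unfolding sq using that by (auto split: if_splits)
  qed
  \<comment> \<open>The middle rows of \<open>B\<close> vanish in the columns \<open>0\<close> and
    \<open>Suc m\<close>, so the middle block of \<open>sq\<close> involves \<open>C\<close>
    alone.\<close>
  have CC: "C * conj_mat C = c \<cdot>\<^sub>m 1\<^sub>m m"
  proof (rule eq_matI)
    fix i j assume "i < dim_row (c \<cdot>\<^sub>m 1\<^sub>m m)" "j < dim_col (c \<cdot>\<^sub>m 1\<^sub>m m)"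
    then have ij: "i < m" "j < m" by auto
    have "(C * conj_mat C) $$ (i, j) = (\<Sum>k<m. C $$ (i, k) * conj_mat C $$ (k, j))"
      by (rule index_mult_sum) (use C ij in auto)
    also have "\<dots> = (\<Sum>k<m. B $$ (Suc i, Suc k) * bar (C $$ (k, j)))"
      by (rule sum.cong) (use ij in \<open>auto simp: C_def\<close>)
    also have "\<dots> = (if i = j then c else 0)"
      using sqi[of "Suc i" j] ij col0[of "Suc i"] coll[of "Suc i"] by simp
    finally show "(C * conj_mat C) $$ (i, j) = (c \<cdot>\<^sub>m 1\<^sub>m m) $$ (i, j)"
      using ij by simp
  qed (use C in auto)
  \<comment> \<open>The last row of \<open>sq\<close> determines the conjugate of the first row of
    \<open>B\<close> from its last row; applying \<open>bar\<close> once more solves for the first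
    row.\<close>
  have r: "B $$ (0, Suc j) = - (\<Sum>k<m. bar (?s k) * C $$ (k, j))" if "j < m" for j
  proof -
    have "bar (B $$ (0, Suc j)) + (\<Sum>k<m. ?s k * bar (C $$ (k, j))) = 0"
      using sqi[of "Suc m" j] that col0[of "Suc m"] coll[of "Suc m"] by simp
    then have "bar (bar (B $$ (0, Suc j)) + (\<Sum>k<m. ?s k * bar (C $$ (k, j)))) = 0" by simp
    then show ?thesis
      by (simp add: hom_add hom_sum hom_mult add_eq_0_iff2)
  qed
  \<comment> \<open>Column \<open>Suc k\<close> is the unit vector corrected by a multiple of
    \<open>e\<^sub>0\<close> so as to lie in the kernel of the projection. Since
    \<open>\<phi> e\<^sub>0\<close> has last coordinate 1, subtracting \<open>bar (?s k)\<close>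
    times \<open>e\<^sub>0\<close> cancels the last coordinate \<open>?s k\<close> of the image
    under \<phi>.\<close>
  define Q where "Q = mat ?n ?n (\<lambda>(i, j). if i = j then 1
    else if i = 0 \<and> j < Suc m then - bar (?s (j - 1)) else 0)"
  have Q: "Q \<in> carrier_mat ?n ?n" by (simp add: Q_def)
  have "det Q = Q $$ (Suc m, Suc m)"
    by (rule prod_diag_ends) (auto simp: Q_def intro!: upper_triangularI)
  then have "Q \<in> carrier (GL ?n)"
    unfolding GL_iff_det[OF Q] by (simp add: Q_def)
  moreover have "B * conj_mat Q = Q * antidiag_border m c 1 C" (is "?L = ?R")
  proof (rule eq_matI)
    fix i j assume "i < dim_row ?R" "j < dim_col ?R"
    then have ij: "i < ?n" "j < ?n" by (simp_all add: Q_def antidiag_border_def)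
    have Qi: "Q $$ (0, 0) = 1" "Q $$ (0, Suc m) = 0" "k < m \<Longrightarrow> Q $$ (0, Suc k) = - bar (?s k)"
      "l < ?n \<Longrightarrow> Q $$ (Suc m, l) = (if l = Suc m then 1 else 0)"
      "k < m \<Longrightarrow> l < ?n \<Longrightarrow> Q $$ (Suc k, l) = (if l = Suc k then 1 else 0)" for k l
      by (auto simp: Q_def)
    have cQ: "conj_mat Q \<in> carrier_mat ?n ?n" "k < ?n \<Longrightarrow> l < ?n \<Longrightarrow> conj_mat Q $$ (k, l) = bar (Q $$ (k, l))"
      for k l using Q by auto
    have L: "l < ?n \<Longrightarrow> ?L $$ (l, 0) = B $$ (l, 0)" "l < ?n \<Longrightarrow> ?L $$ (l, Suc m) = B $$ (l, Suc m)"
      "l < ?n \<Longrightarrow> k < m \<Longrightarrow> ?L $$ (l, Suc k) = B $$ (l, Suc k) - B $$ (l, 0) * ?s k" for k l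
      using index_mult_sum[OF B cQ(1), of l 0] index_mult_sum[OF B cQ(1), of l "Suc m"]
        index_mult_sum[OF B cQ(1), of l "Suc k"]
      by (simp_all add: sum_split_ends cQ(2) Qi hom_uminus sum.delta if_distrib if_distribR cong: if_cong
          del: sum.lessThan_Suc index_mult_mat index_map_mat)
    have R: "?R $$ (i, j) = Q $$ (i, 0) * antidiag_border m c 1 C $$ (0, j)
       + (\<Sum>k<m. Q $$ (i, Suc k) * antidiag_border m c 1 C $$ (Suc k, j))
       + Q $$ (i, Suc m) * antidiag_border m c 1 C $$ (Suc m, j)"
      using index_mult_sum[OF Q border_carrier(1) ij] by (simp add: sum_split_ends del: sum.lessThan_Suc)
    show "?L $$ (i, j) = ?R $$ (i, j)"
      unfolding R
      by (rule border_cases[OF ij(1)]; rule border_cases[OF ij(2)])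
        (simp_all add: L border_index Qi col0 coll r C_def sum_negf if_distrib if_distribR
          cong: if_cong del: index_mult_mat sum.lessThan_Suc)
  qed (use B in \<open>simp_all add: Q_def antidiag_border_def\<close>)
  ultimately have "tweq ?n B (antidiag_border m c 1 C)" by (auto simp: tweq_def)
  with C CC show ?thesis by (rule that)
qed

end

section \<open>The normal form over power series\<close>

definition fps_map :: "('a \<Rightarrow> 'b) \<Rightarrow> 'a fps \<Rightarrow> 'b fps"
  where "fps_map \<sigma> f = Abs_fps (\<lambda>k. \<sigma> (fps_nth f k))"

lemma fps_map_nth [simp]: "fps_nth (fps_map \<sigma> f) k = \<sigma> (fps_nth f k)"
  by (simp add: fps_map_def)

text \<open>The matrix \<open>diag (\<pi> ^ \<nu> i) * w\<close> of the overview; with all exponents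
  zero it is the reversal \<open>w\<close> itself. The test \<open>Suc (i + j) = n\<close> avoids
  truncated subtraction.\<close>

definition antidiag :: "nat \<Rightarrow> (nat \<Rightarrow> nat) \<Rightarrow> 'a::comm_ring_1 fps mat"
  where "antidiag n \<nu> = mat n n (\<lambda>(i, j). if Suc (i + j) = n then fps_X ^ \<nu> i else 0)"

lemma antidiag_carrier [simp]: "antidiag n \<nu> \<in> carrier_mat n n"
  by (simp add: antidiag_def)

lemma antidiag_border_antidiag:
  "antidiag_border m (fps_X ^ d) 1 (antidiag m \<nu>) =
    antidiag (Suc (Suc m)) (\<lambda>i. if i = 0 then d else if i = Suc m then 0 else \<nu> (i - 1))"
  (is "?L = ?R")
proof (rule eq_matI)
  fix i j assume "i < dim_row ?R" "j < dim_col ?R"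
  then have ij: "i < Suc (Suc m)" "j < Suc (Suc m)" by (simp_all add: antidiag_def)
  show "?L $$ (i, j) = ?R $$ (i, j)"
    by (rule border_cases[OF ij(1)]; rule border_cases[OF ij(2)])
      (auto simp: border_index, auto simp: antidiag_def)
qed (simp_all add: antidiag_def antidiag_border_def)

lemma smult_antidiag: "fps_X \<cdot>\<^sub>m antidiag n \<nu> = antidiag n (\<lambda>i. Suc (\<nu> i))"
  by (rule eq_matI) (auto simp: antidiag_def)

lemma (in ring_involution) tweq_smult:
  assumes "tweq n A B" and "A \<in> carrier_mat n n" "B \<in> carrier_mat n n"
  shows "tweq n (c \<cdot>\<^sub>m A) (c \<cdot>\<^sub>m B)"
proof -
  obtain g where g: "g \<in> carrier (GL n)" "A * conj_mat g = g * B"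
    using assms(1) by (auto simp: tweq_def)
  have "(c \<cdot>\<^sub>m A) * conj_mat g = g * (c \<cdot>\<^sub>m B)"
    using g(2) assms(2,3) GL_carrier_mat[OF g(1)]
      mult_smult_assoc_mat[of A n n "conj_mat g" n c] mult_smult_distrib[of g n n B n c] by simp
  with g(1) show ?thesis by (auto simp: tweq_def)
qed

section \<open>Reduction modulo \<pi> and the induction to the normal form\<close>

locale field_involution = ring_involution \<sigma> for \<sigma> :: "'a::field \<Rightarrow> 'a" +
  assumes nontrivial: "\<exists>\<theta>. \<sigma> \<theta> \<noteq> \<theta>"
begin

sublocale fps: ring_involution "fps_map \<sigma>"
  by standard (auto simp: fps_eq_iff hom_add fps_mult_nth hom_sum hom_mult)

lemma fps_map_X [simp]: "fps_map \<sigma> fps_X = fps_X"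
  by (auto simp: fps_eq_iff)

text \<open>Here nontriviality of \<sigma> enters: if equality always held, \<open>c = 1\<close>
  would give \<open>a = b\<close>, and cancelling \<open>a\<close> would make \<sigma> the
  identity.\<close>

lemma exists_semilinear_neq:
  assumes "a \<noteq> 0"
  shows "\<exists>c. a * \<sigma> c \<noteq> b * c"
proof (rule ccontr)
  assume "\<not> ?thesis"
  then have eq: "a * \<sigma> c = b * c" for c by blast
  from eq[of 1] have "a = b" by simp
  with eq assms nontrivial show False by auto
qed

text \<open>The averaging of Hilbert 90: \<open>x \<mapsto> b * bar x\<close> squares to the
  identity, so it fixes \<open>y + b * bar y\<close> for every \<open>y\<close>. A constant
  \<open>y\<close> is chosen to keep the constant term of this sum nonzero.\<close>

lemma fps_hilbert90_rank_one:
  assumes "b * fps_map \<sigma> b = 1"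
  obtains g where "fps_nth g 0 \<noteq> 0" "b * fps_map \<sigma> g = g"
proof -
  have b0: "fps_nth b 0 \<noteq> 0"
    using assms by (metis fps_mult_nth_0 fps_one_nth mult_zero_left zero_neq_one)
  obtain y where y: "fps_nth b 0 * \<sigma> y \<noteq> - 1 * y"
    using exists_semilinear_neq[OF b0] by blast
  let ?g = "fps_const y + b * fps_map \<sigma> (fps_const y)"
  have "b * fps_map \<sigma> ?g = b * fps_map \<sigma> (fps_const y) + b * fps_map \<sigma> b * fps_const y"
    by (simp add: fps.hom_add fps.hom_mult algebra_simps)
  then have "b * fps_map \<sigma> ?g = ?g" using assms by simp
  moreover have "fps_nth ?g 0 \<noteq> 0"
    using y eq_neg_iff_add_eq_0[of "fps_nth b 0 * \<sigma> y" y] by (simp add: add.commute)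
  ultimately show ?thesis by (rule that[rotated])
qed

lemma square_entry:
  assumes B: "B \<in> carrier_mat n n" and sq: "B * fps.conj_mat B = fps_X ^ d \<cdot>\<^sub>m 1\<^sub>m n"
    and "i < n" "j < n"
  shows "(\<Sum>k<n. B $$ (i, k) * fps_map \<sigma> (B $$ (k, j))) = (if i = j then fps_X ^ d else 0)"
proof -
  have "(B * fps.conj_mat B) $$ (i, j) = (\<Sum>k<n. B $$ (i, k) * fps.conj_mat B $$ (k, j))"
    by (rule index_mult_sum) (use assms in auto)
  also have "\<dots> = (\<Sum>k<n. B $$ (i, k) * fps_map \<sigma> (B $$ (k, j)))"
    by (rule sum.cong) (use B \<open>j < n\<close> in auto)
  finally show ?thesis using assms by auto
qed

lemma divide_by_X:
  fixes B :: "'a fps mat"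
  assumes B: "B \<in> carrier_mat n n" and sq: "B * fps.conj_mat B = fps_X ^ d \<cdot>\<^sub>m 1\<^sub>m n"
    and n: "n > 0" and zero: "\<And>i j. i < n \<Longrightarrow> j < n \<Longrightarrow> fps_nth (B $$ (i, j)) 0 = 0"
  obtains B' d' where "B' \<in> carrier_mat n n" "d = Suc (Suc d')" "B = fps_X \<cdot>\<^sub>m B'"
    "B' * fps.conj_mat B' = fps_X ^ d' \<cdot>\<^sub>m 1\<^sub>m n"
proof -
  define B' where "B' = map_mat (fps_shift 1) B"
  have B': "B' \<in> carrier_mat n n" using B by (simp add: B'_def)
  have BB': "B $$ (i, j) = fps_X * B' $$ (i, j)" if "i < n" "j < n" for i j
  proof (rule fps_ext)
    fix k show "fps_nth (B $$ (i, j)) k = fps_nth (fps_X * B' $$ (i, j)) k"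
      using zero[OF that] that B by (cases k) (auto simp: B'_def)
  qed
  have XB: "B = fps_X \<cdot>\<^sub>m B'"
    by (rule eq_matI) (use B B' BB' in auto)
  let ?S = "\<lambda>i j. \<Sum>k<n. B' $$ (i, k) * fps_map \<sigma> (B' $$ (k, j))"
  have S: "fps_X ^ 2 * ?S i j = (if i = j then fps_X ^ d else 0)" if "i < n" "j < n" for i j
  proof -
    have "fps_X ^ 2 * ?S i j = (\<Sum>k<n. B $$ (i, k) * fps_map \<sigma> (B $$ (k, j)))"
      unfolding sum_distrib_left
      by (rule sum.cong) (use that in \<open>auto simp: BB' fps.hom_mult power2_eq_square ac_simps\<close>)
    then show ?thesis using square_entry[OF B sq that] by simp
  qed
  \<comment> \<open>The entry at position \<open>(0, 0)\<close> equates \<open>fps_X ^ d\<close>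
    with a multiple of \<open>fps_X ^ 2\<close>; the coefficients of index \<open>d\<close> are
    compared.\<close>
  have "d \<ge> 2"
  proof (rule ccontr)
    assume "\<not> d \<ge> 2"
    then have "fps_nth (fps_X ^ 2 * ?S 0 0) d = 0" by (simp add: fps_X_power_mult_nth)
    then show False using S[OF n n] by simp
  qed
  then obtain d' where d': "d = Suc (Suc d')"
    by (metis add_2_eq_Suc le_Suc_ex)
  have "B' * fps.conj_mat B' = fps_X ^ d' \<cdot>\<^sub>m 1\<^sub>m n"
  proof (rule eq_matI)
    fix i j assume "i < dim_row (fps_X ^ d' \<cdot>\<^sub>m 1\<^sub>m n :: 'a fps mat)" "j < dim_col (fps_X ^ d' \<cdot>\<^sub>m 1\<^sub>m n :: 'a fps mat)"
    then have ij: "i < n" "j < n" by auto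
    have "(B' * fps.conj_mat B') $$ (i, j) = (\<Sum>k<n. B' $$ (i, k) * fps.conj_mat B' $$ (k, j))"
      by (rule index_mult_sum) (use ij B' in auto)
    also have "\<dots> = ?S i j"
      by (rule sum.cong) (use B' ij in auto)
    also have "fps_X ^ 2 * ?S i j = fps_X ^ 2 * (fps_X ^ d' \<cdot>\<^sub>m 1\<^sub>m n) $$ (i, j)"
      unfolding S[OF ij] using ij d' by (simp add: power2_eq_square mult.assoc)
    then have "?S i j = (fps_X ^ d' \<cdot>\<^sub>m 1\<^sub>m n) $$ (i, j)" by simp
    finally show "(B' * fps.conj_mat B') $$ (i, j) = (fps_X ^ d' \<cdot>\<^sub>m 1\<^sub>m n) $$ (i, j)" .
  qed (use B' in auto)
  with B' d' XB show ?thesis by (rule that)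
qed

text \<open>Provides the vector independent of its image modulo \<pi>. A unit off the diagonal is
  renumbered into the corner. If there is none, the reduction is diagonal, \<open>d\<close> must be
  0, all diagonal entries are units, and \<open>e\<^sub>0\<close> plus a suitable multiple of the
  last basis vector works.\<close>

lemma corner_unit:
  fixes B :: "'a fps mat"
  assumes B: "B \<in> carrier_mat (Suc (Suc m)) (Suc (Suc m))"
    and sq: "B * fps.conj_mat B = fps_X ^ d \<cdot>\<^sub>m 1\<^sub>m (Suc (Suc m))"
    and ij: "i < Suc (Suc m)" "j < Suc (Suc m)" "fps_nth (B $$ (i, j)) 0 \<noteq> 0"
  obtains B' where "B' \<in> carrier_mat (Suc (Suc m)) (Suc (Suc m))" "fps.tweq (Suc (Suc m)) B B'"
    "fps_nth (B' $$ (Suc m, 0)) 0 \<noteq> 0"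
proof (cases "\<exists>i j. i < Suc (Suc m) \<and> j < Suc (Suc m) \<and> i \<noteq> j \<and> fps_nth (B $$ (i, j)) 0 \<noteq> 0")
  case True
  then obtain i j where ij: "i < Suc (Suc m)" "j < Suc (Suc m)" "i \<noteq> j" "fps_nth (B $$ (i, j)) 0 \<noteq> 0"
    by blast
  \<comment> \<open>The outer transposition takes \<open>0\<close> to \<open>j\<close>. The inner
    one sends \<open>Suc m\<close> to the preimage of \<open>i\<close> and leaves \<open>0\<close>
    alone, as that preimage is nonzero for \<open>i \<noteq> j\<close>.\<close>
  define \<tau> where "\<tau> = transpose 0 j \<circ> transpose (Suc m) (transpose 0 j i)"
  have less: "transpose a b c < k" if "a < k" "b < k" "c < k" for a b c k :: nat
    using that by (simp add: transpose_def)
  have bij: "bij_betw (transpose a b) {..<k} {..<k}" if "a < k" "b < k" for a b k :: nat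
    by (rule bij_betw_byWitness[where f' = "transpose a b"]) (use that less in auto)
  have "transpose 0 j i \<noteq> 0"
    using ij(3) by (auto simp: transpose_def)
  then have \<tau>: "\<tau> 0 = j" "\<tau> (Suc m) = i"
    by (simp_all add: \<tau>_def)
  have bij: "bij_betw \<tau> {..<Suc (Suc m)} {..<Suc (Suc m)}"
    unfolding \<tau>_def by (rule bij_betw_trans; rule bij) (use ij less in auto)
  show ?thesis
    by (rule that[OF _ fps.tweq_permute[OF B bij]]) (use ij \<tau> in auto)
next
  case False
  then have off: "fps_nth (B $$ (i, j)) 0 = 0" if "i < Suc (Suc m)" "j < Suc (Suc m)" "i \<noteq> j" for i j
    using that by blast
  have diag: "fps_nth (B $$ (k, k)) 0 * \<sigma> (fps_nth (B $$ (k, k)) 0) = (if d = 0 then 1 else 0)"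
    if k: "k < Suc (Suc m)" for k
  proof -
    have "(\<Sum>l<Suc (Suc m). fps_nth (B $$ (k, l)) 0 * \<sigma> (fps_nth (B $$ (l, k)) 0)) =
        (\<Sum>l<Suc (Suc m). if l = k then fps_nth (B $$ (k, k)) 0 * \<sigma> (fps_nth (B $$ (k, k)) 0) else 0)"
      by (rule sum.cong) (use off k in auto)
    moreover have "fps_nth (\<Sum>l<Suc (Suc m). B $$ (k, l) * fps_map \<sigma> (B $$ (l, k))) 0
        = fps_nth (fps_X ^ d) 0"
      using square_entry[OF B sq k k] by simp
    ultimately show ?thesis
      using k by (simp add: fps_sum_nth del: sum.lessThan_Suc split: if_splits)
  qed
  have "i = j" using off ij by blast
  then have "fps_nth (B $$ (i, i)) 0 * \<sigma> (fps_nth (B $$ (i, i)) 0) \<noteq> 0"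
    using ij(3) by (metis bar_bar hom_zero mult_eq_0_iff)
  then have "d = 0" using diag[OF ij(1)] by (auto split: if_splits)
  then have nz: "fps_nth (B $$ (Suc m, Suc m)) 0 \<noteq> 0"
    using diag[of "Suc m"] by auto
  \<comment> \<open>The difference of the two sides is the constant term of the new corner, because
    the off-diagonal entries vanish modulo \<pi>.\<close>
  obtain c where c: "fps_nth (B $$ (Suc m, Suc m)) 0 * \<sigma> c \<noteq> fps_nth (B $$ (0, 0)) 0 * c"
    using exists_semilinear_neq[OF nz] by blast
  obtain B' where B': "B' \<in> carrier_mat (Suc (Suc m)) (Suc (Suc m))" "fps.tweq (Suc (Suc m)) B B'"
    "B' $$ (Suc m, 0) = B $$ (Suc m, 0) + B $$ (Suc m, Suc m) * fps_map \<sigma> (fps_const c)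
       - fps_const c * (B $$ (0, 0) + B $$ (0, Suc m) * fps_map \<sigma> (fps_const c))"
    by (rule fps.tweq_elementary[OF B])
  show ?thesis
    by (rule that[OF B'(1,2)])
      (use c off[of "Suc m" 0] off[of 0 "Suc m"] in \<open>simp add: B'(3) mult.commute\<close>)
qed

text \<open>Dividing by \<pi> lowers \<open>d\<close> by two and splitting off a plane lowers
  \<open>n\<close> by two, hence the induction on \<open>n + d\<close>. The bound
  \<open>\<nu> i \<le> d\<close> belongs to the claim because the sequence is bordered by
  \<open>d\<close> in front and \<open>0\<close> behind, and must stay dominant.\<close>

theorem antidiag_normal_form:
  assumes "B \<in> carrier_mat n n" and "B * fps.conj_mat B = fps_X ^ d \<cdot>\<^sub>m 1\<^sub>m n"
  shows "\<exists>\<nu>. (\<forall>i j. i \<le> j \<longrightarrow> j < n \<longrightarrow> \<nu> j \<le> \<nu> i) \<and> (\<forall>i<n. \<nu> i \<le> d) \<and> fps.tweq n B (antidiag n \<nu>)"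
  using assms
proof (induction "n + d" arbitrary: n d B rule: less_induct)
  case less
  note B = less.prems(1) and sq = less.prems(2)
  consider "n = 0" | "n > 0" "\<And>i j. i < n \<Longrightarrow> j < n \<Longrightarrow> fps_nth (B $$ (i, j)) 0 = 0"
    | "n = 1" "fps_nth (B $$ (0, 0)) 0 \<noteq> 0"
    | m i j where "n = Suc (Suc m)" "i < n" "j < n" "fps_nth (B $$ (i, j)) 0 \<noteq> 0"
    by (metis One_nat_def gr0I less_one old.nat.exhaust)
  then show ?case
  proof cases
    case 1
    have "fps.tweq n B (antidiag n (\<lambda>_. 0))"
      unfolding fps.tweq_def
      by (rule bexI[of _ "1\<^sub>m n"]) (use B 1 in \<open>auto simp: GL_iff_det antidiag_def\<close>)
    with 1 show ?thesis by auto
  next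
    case 2
    obtain B' d' where B': "B' \<in> carrier_mat n n" "d = Suc (Suc d')" "B = fps_X \<cdot>\<^sub>m B'"
      "B' * fps.conj_mat B' = fps_X ^ d' \<cdot>\<^sub>m 1\<^sub>m n"
      by (rule divide_by_X[OF B sq 2])
    obtain \<nu> where \<nu>: "\<forall>i j. i \<le> j \<longrightarrow> j < n \<longrightarrow> \<nu> j \<le> \<nu> i" "\<forall>i<n. \<nu> i \<le> d'"
      "fps.tweq n B' (antidiag n \<nu>)"
      using less.hyps[OF _ B'(1,4)] B'(2) by auto
    have "fps.tweq n B (antidiag n (\<lambda>i. Suc (\<nu> i)))"
      using fps.tweq_smult[OF \<nu>(3) B'(1) antidiag_carrier, of fps_X]
      unfolding B'(3) smult_antidiag .
    moreover have "Suc (\<nu> i) \<le> d" if "i < n" for i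
      using \<nu>(2)[rule_format, OF that] B'(2) by simp
    ultimately show ?thesis
      using \<nu>(1) by (intro exI[of _ "\<lambda>i. Suc (\<nu> i)"]) simp
  next
    case 3
    let ?b = "B $$ (0, 0)"
    have eq: "?b * fps_map \<sigma> ?b = fps_X ^ d"
      using square_entry[OF B sq, of 0 0] 3(1) by simp
    \<comment> \<open>A unit entry forces \<open>d = 0\<close>, so the entry has norm 1.\<close>
    then have "fps_nth (fps_X ^ d :: 'a fps) 0 \<noteq> 0"
      using 3(2) by (metis bar_bar fps_map_nth fps_mult_nth_0 hom_zero mult_eq_0_iff)
    then have "d = 0" by (auto split: if_splits)
    then obtain g where g: "fps_nth g 0 \<noteq> 0" "?b * fps_map \<sigma> g = g"
      using fps_hilbert90_rank_one eq by auto
    let ?g = "mat 1 1 (\<lambda>_. g)"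
    have "?g \<in> carrier (GL n)"
      by (subst GL_iff_det) (use g 3 in \<open>auto simp: det_single\<close>)
    moreover have "B * fps.conj_mat ?g = ?g * antidiag n (\<lambda>_. 0)"
      by (rule eq_matI) (use B g 3 in \<open>auto simp: antidiag_def scalar_prod_def\<close>)
    ultimately have "fps.tweq n B (antidiag n (\<lambda>_. 0))"
      unfolding fps.tweq_def by blast
    then show ?thesis by auto
  next
    case 4
    note n = 4(1)
    note B = B[unfolded n] and sq = sq[unfolded n]
    obtain B1 where B1: "B1 \<in> carrier_mat (Suc (Suc m)) (Suc (Suc m))" "fps.tweq (Suc (Suc m)) B B1"
      "fps_nth (B1 $$ (Suc m, 0)) 0 \<noteq> 0"
      by (rule corner_unit[OF B sq 4(2-4)[unfolded n]])
    note sq1 = fps.tweq_square[OF B1(2) B B1(1) sq]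
    obtain B2 where B2: "B2 \<in> carrier_mat (Suc (Suc m)) (Suc (Suc m))" "fps.tweq (Suc (Suc m)) B1 B2"
      "\<And>i. i < Suc (Suc m) \<Longrightarrow> B2 $$ (i, 0) = (if i = Suc m then 1 else 0)"
      "\<And>i. i < Suc (Suc m) \<Longrightarrow> B2 $$ (i, Suc m) = (if i = 0 then fps_X ^ d else 0)"
      using fps.tweq_normalize_columns[OF B1(1) sq1] B1(3) by (metis fps_is_unit_iff)
    note sq2 = fps.tweq_square[OF B2(2) B1(1) B2(1) sq1]
    obtain C where C: "C \<in> carrier_mat m m" "C * fps.conj_mat C = fps_X ^ d \<cdot>\<^sub>m 1\<^sub>m m"
      "fps.tweq (Suc (Suc m)) B2 (antidiag_border m (fps_X ^ d) 1 C)"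
      by (rule fps.tweq_split_block[OF B2(1) sq2 B2(3,4)])
    obtain \<nu> where \<nu>: "\<forall>i j. i \<le> j \<longrightarrow> j < m \<longrightarrow> \<nu> j \<le> \<nu> i" "\<forall>i<m. \<nu> i \<le> d"
      "fps.tweq m C (antidiag m \<nu>)"
      using less.hyps[OF _ C(1,2)] n by auto
    let ?\<nu> = "\<lambda>i. if i = 0 then d else if i = Suc m then 0 else \<nu> (i - 1)"
    have "fps.tweq n B (antidiag n ?\<nu>)"
      using fps.tweq_diag_border[OF \<nu>(3) C(1) antidiag_carrier, of "fps_X ^ d" 1] C(3) B2(2) B1(2)
        fps.tweq_trans B B1(1) B2(1) border_carrier(1) antidiag_carrier
      unfolding n antidiag_border_antidiag[symmetric] by metis
    moreover have "\<forall>i j. i \<le> j \<longrightarrow> j < n \<longrightarrow> ?\<nu> j \<le> ?\<nu> i"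
    proof (intro allI impI)
      fix i j assume "i \<le> j" "j < n"
      then show "?\<nu> j \<le> ?\<nu> i"
        using \<nu>(1)[rule_format, of "i - 1" "j - 1"] \<nu>(2)[rule_format, of "j - 1"] n by auto
    qed
    moreover have "\<forall>i<n. ?\<nu> i \<le> d"
    proof (intro allI impI)
      fix i assume "i < n"
      then show "?\<nu> i \<le> d"
        using \<nu>(2)[rule_format, of "i - 1"] n by auto
    qed
    ultimately show ?thesis by (intro exI[of _ ?\<nu>] conjI)
  qed
qed

end

section \<open>Norms in a quadratic extension\<close>

text \<open>
  Solves \<open>s * bar s = u\<close> coefficientwise, starting from \<open>s0 * \<sigma> s0 = u 0\<close>. Each of the two terms
  \<open>s0 * \<sigma> (s n)\<close> and \<open>s n * \<sigma> s0\<close> takes half of what is left of \<open>u n\<close>.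
\<close>

fun norm_root_coeff :: "('a::field \<Rightarrow> 'a) \<Rightarrow> 'a \<Rightarrow> (nat \<Rightarrow> 'a) \<Rightarrow> nat \<Rightarrow> 'a" where
  "norm_root_coeff \<sigma> s0 u n = (if n = 0 then s0 else
    (u n - (\<Sum>i\<in>{1..<n}. norm_root_coeff \<sigma> s0 u i * \<sigma> (norm_root_coeff \<sigma> s0 u (n - i)))) / (2 * \<sigma> s0))"

declare norm_root_coeff.simps [simp del]

locale finite_field_involution = field_involution +
  assumes finite_field: "finite (UNIV :: 'a set)" and two_neq_zero: "(2 :: 'a) \<noteq> 0"
begin

text \<open>
  With \<open>\<sigma> \<delta> = - \<delta>\<close> and \<open>D = \<delta>\<^sup>2\<close> the norm of \<open>a + b \<delta>\<close> is \<open>a\<^sup>2 - D b\<^sup>2\<close>. More than half of the fixed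
  field consists of squares, so \<open>a\<^sup>2\<close> and \<open>u + D b\<^sup>2\<close> take a common value.
\<close>

lemma field_norm_surj:
  assumes u: "\<sigma> u = u"
  shows "\<exists>s. s * \<sigma> s = u"
proof -
  obtain \<theta> where "\<sigma> \<theta> \<noteq> \<theta>" using nontrivial by blast
  define \<delta> where "\<delta> = \<theta> - \<sigma> \<theta>"
  have \<delta>: "\<delta> \<noteq> 0" "\<sigma> \<delta> = - \<delta>"
    using \<open>\<sigma> \<theta> \<noteq> \<theta>\<close> by (auto simp: \<delta>_def hom_minus)
  define F where "F = {x. \<sigma> x = x}"
  define S where "S = (\<lambda>a. a\<^sup>2) ` F"
  define T where "T = (\<lambda>y. u + \<delta>\<^sup>2 * y) ` S"
  have fin: "finite F" "finite S" "finite T"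
    using finite_field by (auto intro: finite_subset)
  have sub: "S \<subseteq> F" "T \<subseteq> F"
    using u \<delta> by (auto simp: T_def S_def F_def hom_add hom_mult hom_power)
  have "card T = card S"
    unfolding T_def by (rule card_image) (use \<delta> in \<open>auto simp: inj_on_def\<close>)
  \<comment> \<open>A chosen square root on \<open>S\<close>. Every element of \<open>F\<close> is
    \<open>r y\<close> or \<open>- r y\<close>, and zero needs one sign, so \<open>F\<close> has
    fewer than twice as many elements as \<open>S\<close>.\<close>
  define r where "r y = (SOME a. a \<in> F \<and> a\<^sup>2 = y)" for y
  have r: "(r y)\<^sup>2 = y" if "y \<in> S" for y
    using that someI_ex[of "\<lambda>a. a \<in> F \<and> a\<^sup>2 = y"] by (auto simp: r_def S_def)
  have "a \<in> r ` S \<union> (\<lambda>y. - r y) ` (S - {0})" if a: "a \<in> F" for a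
  proof -
    have aS: "a\<^sup>2 \<in> S" using a by (simp add: S_def)
    have "a = r (a\<^sup>2) \<or> a = - r (a\<^sup>2)"
      using r[OF aS] power2_eq_iff[of "r (a\<^sup>2)" a] by auto
    then show ?thesis
      using aS r[OF aS] by (cases "a = 0") auto
  qed
  then have "F \<subseteq> r ` S \<union> (\<lambda>y. - r y) ` (S - {0})" by blast
  then have "card F \<le> card (r ` S \<union> (\<lambda>y. - r y) ` (S - {0}))"
    using fin by (intro card_mono) auto
  also have "\<dots> \<le> card (r ` S) + card ((\<lambda>y. - r y) ` (S - {0}))"
    by (rule card_Un_le)
  also have "\<dots> \<le> card S + card (S - {0})"
    using fin by (intro add_mono card_image_le) auto
  also have "0 \<in> S" by (auto simp: S_def F_def intro!: image_eqI[of _ _ 0])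
  then have "card S + card (S - {0}) < card S + card S"
    using card_Diff1_less[OF fin(2)] by simp
  finally have "card F < card S + card T"
    using \<open>card T = card S\<close> by simp
  moreover have "card (S \<union> T) \<le> card F"
    using sub fin by (intro card_mono) auto
  ultimately have "S \<inter> T \<noteq> {}"
    using card_Un_disjoint[OF fin(2,3)] by auto
  then obtain a b where ab: "\<sigma> a = a" "\<sigma> b = b" "a\<^sup>2 = u + \<delta>\<^sup>2 * b\<^sup>2"
    by (auto simp: S_def T_def F_def)
  have "(a + b * \<delta>) * \<sigma> (a + b * \<delta>) = a\<^sup>2 - \<delta>\<^sup>2 * b\<^sup>2"
    by (simp add: hom_add hom_mult ab(1,2) \<delta>(2) power2_eq_square algebra_simps)
  then show ?thesis using ab(3) by auto
qed

lemma fps_norm_surj: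
  assumes u: "fps_map \<sigma> u = u" and u0: "fps_nth u 0 \<noteq> 0"
  obtains s where "s * fps_map \<sigma> s = u" "fps_nth s 0 \<noteq> 0"
proof -
  have fixed: "\<sigma> (fps_nth u k) = fps_nth u k" for k
    using u by (metis fps_map_nth)
  obtain s0 where s0: "s0 * \<sigma> s0 = fps_nth u 0"
    using field_norm_surj[OF fixed] by blast
  then have nz: "s0 \<noteq> 0" "\<sigma> s0 \<noteq> 0" using u0 by auto
  define c where "c = norm_root_coeff \<sigma> s0 (fps_nth u)"
  define R where "R n = fps_nth u n - (\<Sum>i\<in>{1..<n}. c i * \<sigma> (c (n - i)))" for n
  have c0: "c 0 = s0" by (simp add: c_def norm_root_coeff.simps)
  have cn: "c n = R n / (2 * \<sigma> s0)" if "n > 0" for n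
    using that by (simp add: c_def R_def norm_root_coeff.simps[of _ _ _ n])
  \<comment> \<open>Replacing \<open>i\<close> by \<open>n - i\<close> exchanges the two factors of
    each summand. As the remainder is thus fixed by \<sigma>, the two conjugate terms can each
    supply half of it.\<close>
  have "\<sigma> (R n) = R n" for n
  proof -
    have "\<sigma> (\<Sum>i\<in>{1..<n}. c i * \<sigma> (c (n - i))) = (\<Sum>i\<in>{1..<n}. \<sigma> (c i) * c (n - i))"
      by (simp add: hom_sum hom_mult)
    also have "\<dots> = (\<Sum>i\<in>{1..<n}. \<sigma> (c (n + 1 - Suc i)) * c (n - (n + 1 - Suc i)))"
      by (rule sum.atLeastLessThan_rev)
    also have "\<dots> = (\<Sum>i\<in>{1..<n}. c i * \<sigma> (c (n - i)))"
      by (rule sum.cong) auto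
    finally show ?thesis by (simp add: R_def hom_minus fixed)
  qed
  then have \<sigma>cn: "\<sigma> (c n) = R n / (2 * s0)" if "n > 0" for n
  proof -
    have "c n * (2 * \<sigma> s0) = R n" using cn[OF that] nz two_neq_zero by simp
    then have "\<sigma> (c n * (2 * \<sigma> s0)) = \<sigma> (R n)" by simp
    moreover have "\<sigma> 2 = 2" using hom_add[of 1 1] by simp
    ultimately have "\<sigma> (c n) * (2 * s0) = R n"
      using \<open>\<sigma> (R n) = R n\<close> by (simp add: hom_mult)
    then show ?thesis using nz two_neq_zero by (simp add: field_simps)
  qed
  have "Abs_fps c * fps_map \<sigma> (Abs_fps c) = u"
  proof (rule fps_ext)
    fix n
    show "fps_nth (Abs_fps c * fps_map \<sigma> (Abs_fps c)) n = fps_nth u n"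
    proof (cases n)
      case 0
      then show ?thesis by (simp add: c0 s0)
    next
      case (Suc m)
      have "fps_nth (Abs_fps c * fps_map \<sigma> (Abs_fps c)) n = (\<Sum>i\<in>{0..n}. c i * \<sigma> (c (n - i)))"
        by (simp add: fps_mult_nth)
      also have "\<dots> = c 0 * \<sigma> (c n) + (\<Sum>i\<in>{1..<n}. c i * \<sigma> (c (n - i))) + c n * \<sigma> (c 0)"
      proof -
        have "{0..n} = insert 0 (insert n {1..<n})" using Suc by auto
        then show ?thesis using Suc by (simp add: add_ac)
      qed
      also have "c 0 * \<sigma> (c n) = R n / 2"
        using Suc nz by (simp add: c0 \<sigma>cn)
      also have "c n * \<sigma> (c 0) = R n / 2"
        using Suc nz by (simp add: c0 cn)
      finally have "fps_nth (Abs_fps c * fps_map \<sigma> (Abs_fps c)) n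
          = (R n / 2 + R n / 2) + (\<Sum>i\<in>{1..<n}. c i * \<sigma> (c (n - i)))"
        by (simp add: add_ac)
      also have "R n / 2 + R n / 2 = R n"
        using two_neq_zero by (metis add_divide_distrib mult_2 nonzero_mult_div_cancel_left)
      finally show ?thesis by (simp add: R_def)
    qed
  qed
  moreover have "fps_nth (Abs_fps c) 0 \<noteq> 0" using nz by (simp add: c0)
  ultimately show ?thesis by (rule that)
qed

end

text \<open>That \<sigma> has order two must be derived. Counting shows that 1 and any \<theta>
  moved by \<sigma> generate the extension, so it suffices to compute
  \<open>\<sigma> (\<sigma> \<theta>)\<close>.\<close>

lemma quadratic_extension_involution:
  fixes \<iota> :: "'k::{field,finite} \<Rightarrow> 'l::field"
  assumes ext: "quadratic_extension \<iota>" and aut: "nontrivial_automorphism \<iota> \<sigma>"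
    and two: "(2 :: 'k) \<noteq> 0"
  shows "finite_field_involution \<sigma>"
proof -
  interpret i: comm_ring_hom \<iota> using ext by (simp add: quadratic_extension_def)
  interpret s: comm_ring_hom \<sigma> using aut by (simp add: nontrivial_automorphism_def)
  interpret vector_space "\<lambda>a x. \<iota> a * x"
    by unfold_locales (auto simp: algebra_simps i.hom_add i.hom_mult)
  have inj: "\<iota> a = \<iota> b \<longleftrightarrow> a = b" for a b
  proof
    assume "\<iota> a = \<iota> b"
    then have "\<iota> (a - b) = 0" by (simp add: i.hom_minus)
    then have "\<iota> ((a - b) * inverse (a - b)) = 0" by (simp only: i.hom_mult) simp
    then show "a = b" by (cases "a = b") auto
  qed simp
  have \<sigma>\<iota>: "\<sigma> (\<iota> a) = \<iota> a" for a
    using aut by (auto simp: nontrivial_automorphism_def fun_eq_iff)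
  obtain \<theta> where \<theta>: "\<sigma> \<theta> \<noteq> \<theta>"
    using aut by (auto simp: nontrivial_automorphism_def fun_eq_iff)
  obtain B where B: "UNIV \<subseteq> span B" "card B = 2"
    using basis_exists[of UNIV] ext by (auto simp: quadratic_extension_def)
  then obtain b1 b2 where b: "B = {b1, b2}" by (auto simp: card_2_iff)
  have "x \<in> (\<lambda>(a, b). \<iota> a * b1 + \<iota> b * b2) ` UNIV" for x
  proof -
    have "x \<in> span {b1, b2}" using B b by auto
    then obtain k1 where "x - \<iota> k1 * b1 \<in> span {b2}" by (auto simp: span_insert)
    then obtain k2 where "x - \<iota> k1 * b1 - \<iota> k2 * b2 = 0" by (auto simp: span_insert)
    then have "x = \<iota> k1 * b1 + \<iota> k2 * b2" by (simp add: algebra_simps)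
    then show ?thesis by auto
  qed
  then have UNIV: "(UNIV :: 'l set) \<subseteq> (\<lambda>(a, b). \<iota> a * b1 + \<iota> b * b2) ` UNIV" by blast
  then have fin: "finite (UNIV :: 'l set)" by (rule finite_subset) simp
  have "card (UNIV :: 'l set) \<le> card (UNIV :: ('k \<times> 'k) set)"
    by (rule order_trans[OF card_mono[OF _ UNIV] card_image_le]) auto
  \<comment> \<open>Applying \<sigma> to an equality and subtracting isolates the coefficient of
    \<open>\<theta> - \<sigma> \<theta>\<close>. By cardinality the injection is then onto.\<close>
  moreover have "inj (\<lambda>(a, b). \<iota> a + \<iota> b * \<theta>)"
  proof (rule injI, clarify)
    fix a b a' b' assume eq: "\<iota> a + \<iota> b * \<theta> = \<iota> a' + \<iota> b' * \<theta>"
    then have "\<sigma> (\<iota> a + \<iota> b * \<theta>) = \<sigma> (\<iota> a' + \<iota> b' * \<theta>)" by simp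
    then have "\<iota> a + \<iota> b * \<sigma> \<theta> = \<iota> a' + \<iota> b' * \<sigma> \<theta>" by (simp add: s.hom_add s.hom_mult \<sigma>\<iota>)
    with eq have "(\<iota> a + \<iota> b * \<theta>) - (\<iota> a + \<iota> b * \<sigma> \<theta>) = (\<iota> a' + \<iota> b' * \<theta>) - (\<iota> a' + \<iota> b' * \<sigma> \<theta>)"
      by simp
    then have "(\<iota> b - \<iota> b') * (\<theta> - \<sigma> \<theta>) = 0" by (simp add: algebra_simps)
    then have "\<iota> b = \<iota> b'" using \<theta> by auto
    with eq show "a = a' \<and> b = b'" by (simp add: inj)
  qed
  then have "card (range (\<lambda>(a, b). \<iota> a + \<iota> b * \<theta>)) = card (UNIV :: ('k \<times> 'k) set)"
    by (rule card_image)
  ultimately have range: "range (\<lambda>(a, b). \<iota> a + \<iota> b * \<theta>) = UNIV"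
    using card_seteq[OF fin, of "range (\<lambda>(a, b). \<iota> a + \<iota> b * \<theta>)"] by auto
  have rep: "\<exists>a b. x = \<iota> a + \<iota> b * \<theta>" for x
  proof -
    have "x \<in> range (\<lambda>(a, b). \<iota> a + \<iota> b * \<theta>)" unfolding range by simp
    then show ?thesis by auto
  qed
  \<comment> \<open>Both \<theta> and \<open>\<sigma> \<theta>\<close> are roots of one monic
    quadratic over the base field; being distinct, they have sum \<open>\<iota> r\<close>.\<close>
  obtain p r where pr: "\<theta> * \<theta> = \<iota> p + \<iota> r * \<theta>" using rep by blast
  then have "\<sigma> (\<theta> * \<theta>) = \<sigma> (\<iota> p + \<iota> r * \<theta>)" by simp
  then have "\<sigma> \<theta> * \<sigma> \<theta> = \<iota> p + \<iota> r * \<sigma> \<theta>" by (simp add: s.hom_add s.hom_mult \<sigma>\<iota>)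
  with pr have "\<theta> * \<theta> - \<sigma> \<theta> * \<sigma> \<theta> = (\<iota> p + \<iota> r * \<theta>) - (\<iota> p + \<iota> r * \<sigma> \<theta>)" by simp
  then have "(\<theta> - \<sigma> \<theta>) * (\<theta> + \<sigma> \<theta> - \<iota> r) = 0" by (simp add: algebra_simps)
  then have "\<theta> + \<sigma> \<theta> - \<iota> r = 0" using \<theta> by (metis eq_iff_diff_eq_0 mult_eq_0_iff)
  then have \<sigma>\<theta>: "\<sigma> \<theta> = \<iota> r - \<theta>" by (simp add: algebra_simps)
  then have \<sigma>\<sigma>\<theta>: "\<sigma> (\<sigma> \<theta>) = \<theta>" by (simp add: s.hom_minus \<sigma>\<iota>)
  have "\<sigma> (\<sigma> x) = x" for x
    using rep[of x] by (auto simp: s.hom_add s.hom_mult \<sigma>\<iota> \<sigma>\<sigma>\<theta>)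
  moreover have "(2 :: 'l) \<noteq> 0"
    using two inj[of 2 0] i.hom_add[of 1 1] by simp
  ultimately show ?thesis
    by unfold_locales (use \<theta> fin in auto)
qed

section \<open>Uniqueness in the Cartan decomposition\<close>

text \<open>The zero block has \<open>n - k\<close> rows and \<open>k + 1\<close> columns, in total
  one more than \<open>n\<close>, so by pigeonhole every permutation in the Leibniz formula meets
  it.\<close>

lemma det_zero_block:
  fixes M :: "'a::comm_ring_1 mat"
  assumes M: "M \<in> carrier_mat n n" and k: "k < n"
    and zero: "\<And>i j. k \<le> i \<Longrightarrow> i < n \<Longrightarrow> j \<le> k \<Longrightarrow> M $$ (i, j) = 0"
  shows "det M = 0"
  unfolding det_def'[OF M]
proof (rule sum.neutral, clarify)
  fix p assume p: "p permutes {0..<n}"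
  have "\<exists>i. k \<le> i \<and> i < n \<and> p i \<le> k"
  proof (rule ccontr)
    assume neg: "\<not> ?thesis"
    have "p ` {k..<n} \<subseteq> {Suc k..<n}"
    proof
      fix y assume "y \<in> p ` {k..<n}"
      then obtain i where i: "k \<le> i" "i < n" "y = p i" by auto
      with neg have "k < y" by (meson not_le)
      moreover have "y < n" using permutes_in_image[OF p, of i] i by simp
      ultimately show "y \<in> {Suc k..<n}" by simp
    qed
    then have "card (p ` {k..<n}) \<le> card {Suc k..<n}" by (intro card_mono) auto
    moreover have "card (p ` {k..<n}) = card {k..<n}"
      by (rule card_image) (use permutes_inj[OF p] in \<open>auto simp: inj_on_def inj_def\<close>)
    ultimately show False using k by simp
  qed
  then obtain i where "k \<le> i" "i < n" "p i \<le> k" by blast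
  then have "(\<Prod>i = 0..<n. M $$ (i, p i)) = 0"
    using zero by (intro prod_zero bexI[of _ i]) auto
  then show "signof p * (\<Prod>i = 0..<n. M $$ (i, p i)) = 0" by simp
qed

lemma GL_fps_det:
  fixes P :: "'a::field fps mat"
  assumes "P \<in> carrier (GL n)"
  shows "det (map_mat (\<lambda>f. fps_nth f 0) P) \<noteq> 0"
proof -
  interpret comm_ring_hom "\<lambda>f :: 'a fps. fps_nth f 0" by standard auto
  show ?thesis
    using assms GL_iff_det[OF GL_carrier_mat[OF assms]] by simp
qed

lemma fls_X_intpow_mult_eq:
  assumes "fls_X_intpow a * fps_to_fls f = fls_X_intpow b * fps_to_fls g" "a < b"
  shows "fps_nth f 0 = (0 :: 'a::comm_ring_1)"
proof -
  have "fls_nth (fls_X_intpow a * fps_to_fls f) a = fls_nth (fls_X_intpow b * fps_to_fls g) a"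
    using assms by simp
  then show ?thesis
    using \<open>a < b\<close> by (simp add: fls_X_intpow_times_conv_shift)
qed

text \<open>The equations say \<open>diag (\<pi> ^ \<nu>) * P = Q * diag (\<pi> ^ \<mu>)\<close>. If
  \<open>\<nu> k < \<mu> k\<close>, dominance spreads the inequality to a block that is zero in
  \<open>P\<close> modulo \<pi> and large enough to make \<open>P\<close> singular there; the
  opposite inequality does the same to the transpose of \<open>Q\<close>.\<close>

lemma cartan_unique:
  fixes P Q :: "'a::field fps mat"
  assumes P: "P \<in> carrier (GL n)" and Q: "Q \<in> carrier (GL n)"
    and \<nu>: "dominant n \<nu>" and \<mu>: "dominant n \<mu>"
    and eq: "\<And>i j. i < n \<Longrightarrow> j < n \<Longrightarrow>
      fls_X_intpow (\<nu> i) * fps_to_fls (P $$ (i, j)) = fls_X_intpow (\<mu> j) * fps_to_fls (Q $$ (i, j))"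
    and k: "k < n"
  shows "\<nu> k = \<mu> k"
proof (rule antisym)
  let ?c = "map_mat (\<lambda>f :: 'a fps. fps_nth f 0)"
  have carr: "P \<in> carrier_mat n n" "Q \<in> carrier_mat n n"
    using P Q by (auto dest: GL_carrier_mat)
  have Pi: "fps_nth (P $$ (i, j)) 0 = 0" if "\<nu> i < \<mu> j" "i < n" "j < n" for i j
    using fls_X_intpow_mult_eq[OF eq[OF that(2,3)] that(1)] .
  have Qi: "fps_nth (Q $$ (i, j)) 0 = 0" if "\<mu> j < \<nu> i" "i < n" "j < n" for i j
    using fls_X_intpow_mult_eq[OF eq[OF that(2,3), symmetric] that(1)] .
  show "\<mu> k \<le> \<nu> k"
  proof (rule ccontr)
    assume "\<not> \<mu> k \<le> \<nu> k"
    then have "\<nu> i < \<mu> j" if "k \<le> i" "i < n" "j \<le> k" for i j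
      using that k \<nu>[unfolded dominant_def, rule_format, of k i] \<mu>[unfolded dominant_def, rule_format, of j k]
      by linarith
    then have "det (?c P) = 0"
      using carr k by (intro det_zero_block[of _ n k]) (auto intro!: Pi)
    then show False using GL_fps_det[OF P] by simp
  qed
  show "\<nu> k \<le> \<mu> k"
  proof (rule ccontr)
    assume "\<not> \<nu> k \<le> \<mu> k"
    then have "\<mu> i < \<nu> j" if "k \<le> i" "i < n" "j \<le> k" for i j
      using that k \<mu>[unfolded dominant_def, rule_format, of k i] \<nu>[unfolded dominant_def, rule_format, of j k]
      by linarith
    then have "det (transpose_mat (?c Q)) = 0"
      using carr k by (intro det_zero_block[of _ n k]) (auto intro!: Qi)
    then show False using GL_fps_det[OF Q] det_transpose[of "?c Q" n] carr by simp
  qed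
qed

section \<open>Classes in the projective linear group\<close>

lemma pgl_class_mult:
  fixes A B :: "'a::comm_ring_1 mat"
  assumes "A \<in> carrier (GL n)" "B \<in> carrier (GL n)"
  shows "pgl_class n A \<otimes>\<^bsub>PGL n\<^esub> pgl_class n B = pgl_class n (A * B)"
  using normal.rcos_sum[OF normal_scalars assms] by (simp add: PGL_def pgl_class_def)

lemma carrier_PGL: "carrier (PGL n) = pgl_class n ` carrier (GL n :: 'a::comm_ring_1 mat monoid)"
  by (simp add: PGL_def pgl_class_def carrier_FactGroup)

lemma pgl_class_smult:
  fixes A :: "'a::comm_ring_1 mat"
  assumes A: "A \<in> carrier_mat n n" and c: "c dvd 1"
  shows "pgl_class n (c \<cdot>\<^sub>m A) = pgl_class n A"
proof -
  obtain d where d: "1 = c * d" using c by (auto simp: dvd_def)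
  have cA: "c \<cdot>\<^sub>m A \<in> carrier_mat n n" using A by simp
  have smult: "a \<cdot>\<^sub>m (b \<cdot>\<^sub>m A) = (a * b) \<cdot>\<^sub>m A" for a b
    by (rule eq_matI) (auto simp: mult.assoc)
  have unit: "a * b dvd 1" if "a dvd 1" "b dvd 1" for a b :: 'a
    using mult_dvd_mono[OF that] by simp
  have "d dvd 1" using d by (metis dvd_triv_right)
  show ?thesis
    unfolding pgl_class_eq[OF A] pgl_class_eq[OF cA]
  proof (intro equalityI subsetI; clarify)
    fix a :: 'a assume "a dvd 1"
    then show "\<exists>b. a \<cdot>\<^sub>m (c \<cdot>\<^sub>m A) = b \<cdot>\<^sub>m A \<and> b dvd 1"
      using unit[OF _ c] smult by blast
    have "a \<cdot>\<^sub>m A = (a * d) \<cdot>\<^sub>m (c \<cdot>\<^sub>m A)"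
      unfolding smult using d by (metis mult.assoc mult.commute mult.right_neutral)
    then show "\<exists>b. a \<cdot>\<^sub>m A = b \<cdot>\<^sub>m (c \<cdot>\<^sub>m A) \<and> b dvd 1"
      using unit[OF \<open>a dvd 1\<close> \<open>d dvd 1\<close>] by blast
  qed
qed

lemma pgl_class_eq_one:
  fixes A :: "'a::comm_ring_1 mat"
  assumes A: "A \<in> carrier_mat n n" and eq: "pgl_class n A = \<one>\<^bsub>PGL n\<^esub>"
  obtains c where "c dvd 1" "A = c \<cdot>\<^sub>m 1\<^sub>m n"
proof -
  have "1 \<cdot>\<^sub>m A \<in> pgl_class n A"
    unfolding pgl_class_eq[OF A] by (intro CollectI exI[of _ 1]) simp
  moreover have "1 \<cdot>\<^sub>m A = A" by (rule eq_matI) auto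
  ultimately have "A \<in> scalars n" using eq by (simp add: PGL_def)
  then show ?thesis using that by (auto simp: scalars_def)
qed

interpretation fps_to_fls: comm_ring_hom "fps_to_fls :: 'a::comm_ring_1 fps \<Rightarrow> 'a fls"
  by standard (simp_all add: fls_times_fps_to_fls)

lemma fps_to_fls_GL:
  fixes B :: "'a::comm_ring_1 fps mat"
  assumes "B \<in> carrier (GL n)"
  shows "map_mat fps_to_fls B \<in> carrier (GL n)"
proof -
  obtain C where "B \<in> carrier_mat n n" "C \<in> carrier_mat n n" "C * B = 1\<^sub>m n" "B * C = 1\<^sub>m n"
    using assms by (auto simp: carrier_GL_iff)
  then show ?thesis
    unfolding carrier_GL_iff
    by (metis fps_to_fls.mat_hom_mult fps_to_fls.mat_hom_one map_carrier_mat)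
qed

lemma PGL_int_subgroup: "subgroup (PGL_int n) (PGL n :: 'a::comm_ring_1 fls mat set monoid)"
proof -
  let ?h = "\<lambda>B :: 'a fps mat. pgl_class n (map_mat fps_to_fls B)"
  have "group_hom (GL n) (PGL n) ?h"
  proof (intro group_hom.intro group_hom_axioms.intro group_GL group_PGL homI)
    fix A B :: "'a fps mat" assume AB: "A \<in> carrier (GL n)" "B \<in> carrier (GL n)"
    then show "?h A \<in> carrier (PGL n)" by (auto simp: carrier_PGL fps_to_fls_GL)
    show "?h (A \<otimes>\<^bsub>GL n\<^esub> B) = ?h A \<otimes>\<^bsub>PGL n\<^esub> ?h B"
      using AB by (simp add: pgl_class_mult fps_to_fls_GL
        fps_to_fls.mat_hom_mult[OF GL_carrier_mat GL_carrier_mat])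
  qed
  then show ?thesis
    unfolding PGL_int_def by (rule group_hom.img_is_subgroup)
qed

lemma mat_diag_carrier [simp]: "mat_diag n f \<in> carrier_mat n n"
  by (simp add: mat_diag_def)

lemma fls_X_intpow_mult_neg:
  "fls_X_intpow a * fls_X_intpow (- a) = (1 :: 'a::comm_ring_1 fls)"
  "fls_X_intpow (- a) * fls_X_intpow a = (1 :: 'a::comm_ring_1 fls)"
  by (subst fls_X_intpow_times_fls_X_intpow, simp)+

lemma mat_diag_X_GL:
  "mat_diag n (\<lambda>i. fls_X_intpow (\<mu> i) :: 'a::comm_ring_1 fls) \<in> carrier (GL n)"
proof -
  have "mat_diag n (\<lambda>i. fls_X_intpow (\<mu> i)) * mat_diag n (\<lambda>i. fls_X_intpow (- \<mu> i) :: 'a fls) = 1\<^sub>m n"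
    "mat_diag n (\<lambda>i. fls_X_intpow (- \<mu> i)) * mat_diag n (\<lambda>i. fls_X_intpow (\<mu> i) :: 'a fls) = 1\<^sub>m n"
    by (simp_all only: mat_diag_diag fls_X_intpow_mult_neg mat_diag_one)
  then show ?thesis
    unfolding carrier_GL_iff
    by (intro conjI bexI[of _ "mat_diag n (\<lambda>i. fls_X_intpow (- \<mu> i))"]) auto
qed

lemma pi_pow_cong: "(\<And>i. i < n \<Longrightarrow> \<mu> i = \<nu> i) \<Longrightarrow> pi_pow n \<mu> = pi_pow n \<nu>"
  unfolding pi_pow_def by (intro arg_cong[where f = "pgl_class n"] eq_matI) (auto simp: mat_diag_def)

lemma C_ad_iff: "x \<in> C_ad G K t \<longleftrightarrow> (\<exists>k\<in>K. \<exists>k'\<in>K. x = k \<otimes>\<^bsub>G\<^esub> t \<otimes>\<^bsub>G\<^esub> k')"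
  by (auto simp: C_ad_def set_mult_def)

text \<open>The reversal permutation is its own inverse.\<close>

lemma antidiag_GL: "antidiag n (\<lambda>_. 0) \<in> carrier (GL n :: 'a::comm_ring_1 fps mat monoid)"
proof -
  let ?W = "antidiag n (\<lambda>_. 0) :: 'a fps mat"
  have "?W * ?W = 1\<^sub>m n"
  proof (rule eq_matI)
    fix i j assume "i < dim_row (1\<^sub>m n :: 'a fps mat)" "j < dim_col (1\<^sub>m n :: 'a fps mat)"
    then have ij: "i < n" "j < n" by auto
    have "(?W * ?W) $$ (i, j) = (\<Sum>l<n. ?W $$ (i, l) * ?W $$ (l, j))"
      by (rule index_mult_sum) (use ij in auto)
    also have "\<dots> = (\<Sum>l<n. if l = n - Suc i then (if i = j then 1 else 0) else 0)"
      by (rule sum.cong) (use ij in \<open>auto simp: antidiag_def\<close>)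
    also have "\<dots> = 1\<^sub>m n $$ (i, j)" using ij by simp
    finally show "(?W * ?W) $$ (i, j) = 1\<^sub>m n $$ (i, j)" .
  qed (auto simp: antidiag_def)
  then show ?thesis
    unfolding carrier_GL_iff by (intro conjI bexI[of _ ?W]) auto
qed

lemma fls_X_intpow_int: "fls_X_intpow (int k) = fps_to_fls (fps_X ^ k :: 'a::comm_ring_1 fps)"
  by (simp add: fps_to_fls_power fls_X_power_conv_shift_1)

lemma fps_to_fls_antidiag:
  "map_mat fps_to_fls (antidiag n \<nu> :: 'a::comm_ring_1 fps mat) =
    mat_diag n (\<lambda>i. fls_X_intpow (int (\<nu> i))) * map_mat fps_to_fls (antidiag n (\<lambda>_. 0))"
  unfolding fls_X_intpow_int
  by (subst mat_diag_mult_left[of _ n n]) (auto simp: antidiag_def intro!: eq_matI)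

lemma fls_map_fps_to_fls:
  assumes "\<sigma> 0 = 0"
  shows "fls_map \<sigma> (fps_to_fls f) = fps_to_fls (fps_map \<sigma> f)"
  by (rule fls_eqI) (simp add: fls_nth_fls_map assms)

lemma fls_map_X_intpow:
  assumes "comm_ring_hom \<sigma>"
  shows "fls_map \<sigma> (fls_X_intpow k) = fls_X_intpow k"
proof -
  interpret comm_ring_hom \<sigma> by fact
  show ?thesis by (rule fls_eqI) (simp add: fls_nth_fls_map)
qed

text \<open>The sum of the absolute subdegrees of all entries is a common bound. All large
  \<open>M\<close> are allowed because the exponent must later dominate a second quantity as
  well.\<close>

lemma bounded_denominators:
  fixes A :: "'a::comm_ring_1 fls mat"
  assumes A: "A \<in> carrier_mat n n"
  shows "\<exists>N. \<forall>M\<ge>N. \<exists>B\<in>carrier_mat n n. fls_X_intpow (int M) \<cdot>\<^sub>m A = map_mat fps_to_fls B"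
proof -
  let ?s = "\<lambda>p. nat \<bar>fls_subdegree (A $$ p)\<bar>"
  let ?I = "{..<n} \<times> {..<n}"
  have integral: "\<exists>B\<in>carrier_mat n n. fls_X_intpow (int M) \<cdot>\<^sub>m A = map_mat fps_to_fls B"
    if M: "(\<Sum>p\<in>?I. ?s p) \<le> M" for M
  proof -
    let ?B = "map_mat fls_regpart (fls_X_intpow (int M) \<cdot>\<^sub>m A)"
    have "fps_to_fls (fls_regpart (fls_X_intpow (int M) * A $$ (i, j))) = fls_X_intpow (int M) * A $$ (i, j)"
      if "i < n" "j < n" for i j
    proof (rule fls_regpart_to_fls_trivial)
      have "?s (i, j) \<le> (\<Sum>p\<in>?I. ?s p)"
        by (rule member_le_sum) (use that in auto)
      then have "- int M \<le> fls_subdegree (A $$ (i, j))"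
        using M by linarith
      then show "0 \<le> fls_subdegree (fls_X_intpow (int M) * A $$ (i, j))"
        by (cases "A $$ (i, j) = 0") (simp_all add: fls_X_intpow_times_conv_shift)
    qed
    then have "fls_X_intpow (int M) \<cdot>\<^sub>m A = map_mat fps_to_fls ?B"
      by (intro eq_matI) (use A in auto)
    moreover have "?B \<in> carrier_mat n n" using A by simp
    ultimately show ?thesis by blast
  qed
  then show ?thesis by blast
qed

section \<open>The bar on projective classes\<close>

context field_involution
begin

lemma bij_bar: "bij \<sigma>"
  by (rule o_bij[of \<sigma>]) auto

sublocale fls: ring_involution "fls_map \<sigma>"
  by (intro ring_involution.intro ring_involution_axioms.intro
      comm_ring_hom_fls_map comm_ring_hom_axioms bij_is_inj bij_bar fls_eqI)
    (simp add: fls_nth_fls_map)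

lemma conj_fps_to_fls:
  "fls.conj_mat (map_mat fps_to_fls B) = map_mat fps_to_fls (fps.conj_mat B)"
  by (rule eq_matI) (auto simp: fls_map_fps_to_fls)

lemma pgl_bar_class:
  assumes "A \<in> carrier (GL n)"
  shows "pgl_bar \<sigma> (pgl_class n A) = pgl_class n (fls.conj_mat A)"
  using pgl_bar_pgl_class[OF comm_ring_hom_axioms bij_bar GL_carrier_mat[OF assms]] .

lemma pgl_bar_hom: "group_hom (PGL n) (PGL n) (pgl_bar \<sigma>)"
proof (intro group_hom.intro group_hom_axioms.intro group_PGL homI)
  fix x y :: "'a fls mat set" assume "x \<in> carrier (PGL n)" "y \<in> carrier (PGL n)"
  then obtain A B where AB: "x = pgl_class n A" "y = pgl_class n B"
    "A \<in> carrier (GL n)" "B \<in> carrier (GL n)"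
    by (auto simp: carrier_PGL)
  then show "pgl_bar \<sigma> x \<in> carrier (PGL n)"
    by (auto simp: pgl_bar_class carrier_PGL fls.conj_mat_GL)
  show "pgl_bar \<sigma> (x \<otimes>\<^bsub>PGL n\<^esub> y) = pgl_bar \<sigma> x \<otimes>\<^bsub>PGL n\<^esub> pgl_bar \<sigma> y"
    using AB by (simp add: pgl_class_mult pgl_bar_class GL_mult fls.conj_mat_GL
      fls.mat_hom_mult[OF GL_carrier_mat GL_carrier_mat])
qed

end

text \<open>An invertible \<open>A\<close> with \<open>A * conj_mat A\<close> scalar commutes with
  \<open>conj_mat A\<close>, so applying \<open>bar\<close> to the product leaves it
  unchanged.\<close>

lemma (in ring_involution) square_scalar_fixed:
  assumes A: "A \<in> carrier (GL n)" and n: "n > 0" and sq: "A * conj_mat A = c \<cdot>\<^sub>m 1\<^sub>m n"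
  shows "bar c = c"
proof -
  note Ac = GL_carrier_mat[OF A]
  have cA: "conj_mat A \<in> carrier_mat n n" using Ac by simp
  obtain h where h: "h \<in> carrier_mat n n" "h * A = 1\<^sub>m n"
    using A by (auto simp: carrier_GL_iff)
  have "A * (conj_mat A * A) = A * (c \<cdot>\<^sub>m 1\<^sub>m n)"
    using assoc_mult_mat[OF Ac cA Ac] sq smult_one_mult[OF Ac] by simp
  then have "h * (A * (conj_mat A * A)) = h * (A * (c \<cdot>\<^sub>m 1\<^sub>m n))" by simp
  moreover have "h * (A * M) = M" if "M \<in> carrier_mat n n" for M
    using assoc_mult_mat[OF h(1) Ac that] h(2) that by simp
  ultimately have "conj_mat A * A = c \<cdot>\<^sub>m 1\<^sub>m n" using Ac cA by simp
  moreover have "conj_mat A * A = conj_mat (c \<cdot>\<^sub>m 1\<^sub>m n)"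
    using mat_hom_mult[OF Ac cA] sq by simp
  ultimately have "(conj_mat (c \<cdot>\<^sub>m 1\<^sub>m n)) $$ (0, 0) = (c \<cdot>\<^sub>m 1\<^sub>m n) $$ (0, 0)" by simp
  then show ?thesis using n by simp
qed

section \<open>From projective classes to power series matrices and back\<close>

context finite_field_involution
begin

text \<open>Write \<open>c = \<pi> ^ k * v\<close> with \<open>v\<close> a unit fixed by the bar,
  hence a norm \<open>s * bar s\<close>. Scaling \<open>A\<close> by \<open>t\<close>, the inverse
  of \<open>s\<close>, removes \<open>v\<close>; scaling by \<open>\<pi> ^ N\<close> clears
  denominators and gives \<open>d = 2 * N + k\<close>.\<close>

lemma normalize_square:
  fixes A :: "'a fls mat"
  assumes A: "A \<in> carrier (GL n)" and n: "n > 0"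
    and sq: "A * fls.conj_mat A = c \<cdot>\<^sub>m 1\<^sub>m n" and c: "c \<noteq> 0"
  obtains N t B d where "fps_nth t 0 \<noteq> 0" "B \<in> carrier_mat n n"
    "(fls_X_intpow N * fps_to_fls t) \<cdot>\<^sub>m A = map_mat fps_to_fls B"
    "B * fps.conj_mat B = fps_X ^ d \<cdot>\<^sub>m 1\<^sub>m n"
proof -
  note Ac = GL_carrier_mat[OF A]
  define k where "k = fls_subdegree c"
  define v where "v = fls_base_factor_to_fps c"
  have cv: "c = fls_X_intpow k * fps_to_fls v"
    unfolding k_def v_def fps_to_fls_base_factor_to_fps by (rule fls_base_factor_X_power_decompose(2))
  have "fls_map \<sigma> c = c" by (rule fls.square_scalar_fixed[OF A n sq])
  then have "\<sigma> (fls_nth c i) = fls_nth c i" for i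
    by (metis fls_nth_fls_map hom_zero)
  then have "fps_map \<sigma> v = v" by (simp add: fps_eq_iff v_def)
  moreover have "fps_nth v 0 \<noteq> 0" using c by (simp add: v_def)
  ultimately obtain s where s: "s * fps_map \<sigma> s = v" "fps_nth s 0 \<noteq> 0"
    by (rule fps_norm_surj)
  define t where "t = inverse s"
  have ts: "t * s = 1" unfolding t_def by (rule inverse_mult_eq_1[OF s(2)])
  then have t0: "fps_nth t 0 \<noteq> 0" by (metis fps_mult_nth_0 fps_one_nth mult_zero_left zero_neq_one)
  have "fps_map \<sigma> t * fps_map \<sigma> s = 1"
    unfolding fps.hom_mult[symmetric] ts by simp
  then have ttv: "t * fps_map \<sigma> t * v = 1"
    unfolding s(1)[symmetric] using ts by (metis mult.assoc mult.commute mult.right_neutral)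
  have tA: "fps_to_fls t \<cdot>\<^sub>m A \<in> carrier_mat n n" using Ac by simp
  obtain N0 where N0: "\<And>M. M \<ge> N0 \<Longrightarrow>
      \<exists>B\<in>carrier_mat n n. fls_X_intpow (int M) \<cdot>\<^sub>m (fps_to_fls t \<cdot>\<^sub>m A) = map_mat fps_to_fls B"
    using bounded_denominators[OF tA] by blast
  \<comment> \<open>With \<open>N\<close> at least the absolute value of \<open>k\<close>, the
    exponent \<open>2 * N + k\<close> is nonnegative and \<open>nat\<close> does not truncate
    it.\<close>
  define N where "N = max N0 (nat \<bar>k\<bar>)"
  obtain B where B: "B \<in> carrier_mat n n"
    "fls_X_intpow (int N) \<cdot>\<^sub>m (fps_to_fls t \<cdot>\<^sub>m A) = map_mat fps_to_fls B"
    using N0[of N] by (auto simp: N_def)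
  let ?e = "fls_X_intpow (int N) * fps_to_fls t"
  have eA: "?e \<cdot>\<^sub>m A = map_mat fps_to_fls B"
    unfolding B(2)[symmetric] by (rule eq_matI) (auto simp: mult.assoc)
  define d where "d = nat (2 * int N + k)"
  have d: "int d = 2 * int N + k" by (auto simp: d_def N_def)
  have bar_e: "fls_map \<sigma> ?e = fls_X_intpow (int N) * fps_to_fls (fps_map \<sigma> t)"
    by (simp only: fls.hom_mult fls_map_X_intpow[OF comm_ring_hom_axioms] fls_map_fps_to_fls hom_zero)
  have "?e * fls_map \<sigma> ?e * c = (fls_X_intpow (int N) * fls_X_intpow (int N) * fls_X_intpow k)
      * fps_to_fls (t * fps_map \<sigma> t * v)"
    unfolding bar_e cv fls_times_fps_to_fls by (simp only: ac_simps)
  also have "\<dots> = fls_X_intpow (int N + int N + k)"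
    by (simp only: ttv fps_one_to_fls mult_1_right fls_X_intpow_times_fls_X_intpow)
  also have "\<dots> = fps_to_fls (fps_X ^ d)"
    unfolding fls_X_intpow_int[symmetric] d by (simp only: mult_2)
  finally have e: "?e * fls_map \<sigma> ?e * c = fps_to_fls (fps_X ^ d)" .
  have "map_mat fps_to_fls (B * fps.conj_mat B) = map_mat fps_to_fls B * fls.conj_mat (map_mat fps_to_fls B)"
    unfolding conj_fps_to_fls by (rule fps_to_fls.mat_hom_mult) (use B in auto)
  also have "\<dots> = (?e \<cdot>\<^sub>m A) * (fls_map \<sigma> ?e \<cdot>\<^sub>m fls.conj_mat A)"
    unfolding eA[symmetric] by (rule arg_cong2[where f = "(*)"], rule refl, rule eq_matI) (auto simp: fls.hom_mult)
  also have "\<dots> = ?e \<cdot>\<^sub>m (A * (fls_map \<sigma> ?e \<cdot>\<^sub>m fls.conj_mat A))"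
    by (rule mult_smult_assoc_mat[of _ n n _ n]) (use Ac in auto)
  also have "\<dots> = ?e \<cdot>\<^sub>m (fls_map \<sigma> ?e \<cdot>\<^sub>m (c \<cdot>\<^sub>m 1\<^sub>m n))"
    unfolding sq[symmetric] by (subst mult_smult_distrib[of _ n n _ n]) (use Ac in auto)
  also have "\<dots> = (?e * fls_map \<sigma> ?e * c) \<cdot>\<^sub>m 1\<^sub>m n"
    by (rule eq_matI) (auto simp: mult.assoc)
  also have "\<dots> = map_mat fps_to_fls (fps_X ^ d \<cdot>\<^sub>m 1\<^sub>m n)"
    unfolding e by (rule eq_matI) auto
  finally have "map_mat fps_to_fls (B * fps.conj_mat B) = map_mat fps_to_fls (fps_X ^ d \<cdot>\<^sub>m 1\<^sub>m n)" .
  moreover have "X = Y" if "map_mat fps_to_fls X = map_mat fps_to_fls Y" for X Y :: "'a fps mat"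
    using that by (auto simp: mat_eq_iff)
  ultimately have "B * fps.conj_mat B = fps_X ^ d \<cdot>\<^sub>m 1\<^sub>m n" by blast
  with t0 B(1) eA show ?thesis by (rule that)
qed

text \<open>
  The class of the antidiagonal matrix \<open>diag (\<pi> ^ \<mu> i) * w\<close>, \<open>w\<close> the reversal permutation, is a common
  representative of the twisted orbits.
\<close>

lemma twisted_representative:
  assumes n: "n > 0" and \<mu>: "dominant n \<mu>"
    and x: "x \<in> C_ad (PGL n) (PGL_int n) (pi_pow n \<mu>) \<inter> S_ad (PGL n) (pgl_bar \<sigma>)"
  shows "\<exists>g\<in>PGL_int n. x \<otimes>\<^bsub>PGL n\<^esub> pgl_bar \<sigma> g
    = g \<otimes>\<^bsub>PGL n\<^esub> (pi_pow n \<mu> \<otimes>\<^bsub>PGL n\<^esub> pgl_class n (map_mat fps_to_fls (antidiag n (\<lambda>_. 0))))"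
proof -
  let ?M = "map_mat fps_to_fls :: 'a fps mat \<Rightarrow> 'a fls mat"
  let ?D = "\<lambda>\<mu>. mat_diag n (\<lambda>i. fls_X_intpow (\<mu> i)) :: 'a fls mat"
  let ?W = "antidiag n (\<lambda>_. 0) :: 'a fps mat"
  obtain K1 K2 where K: "K1 \<in> carrier (GL n)" "K2 \<in> carrier (GL n)"
    "x = pgl_class n (?M K1) \<otimes>\<^bsub>PGL n\<^esub> pi_pow n \<mu> \<otimes>\<^bsub>PGL n\<^esub> pgl_class n (?M K2)"
    using x by (auto simp: C_ad_iff PGL_int_def)
  define A where "A = ?M K1 * ?D \<mu> * ?M K2"
  have A: "A \<in> carrier (GL n)" and xA: "x = pgl_class n A"
    unfolding A_def K(3) pi_pow_def
    using K(1,2) by (simp_all add: pgl_class_mult GL_mult fps_to_fls_GL mat_diag_X_GL)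
  note Ac = GL_carrier_mat[OF A]
  have "pgl_class n (A * fls.conj_mat A) = \<one>\<^bsub>PGL n\<^esub>"
    using x A by (simp add: S_ad_def xA pgl_bar_class pgl_class_mult fls.conj_mat_GL)
  moreover have "A * fls.conj_mat A \<in> carrier_mat n n" using Ac by simp
  ultimately obtain c where c: "c dvd 1" "A * fls.conj_mat A = c \<cdot>\<^sub>m 1\<^sub>m n"
    by (metis pgl_class_eq_one)
  from c(1) have "c \<noteq> 0" by auto
  obtain N t B d where B: "fps_nth t 0 \<noteq> 0" "B \<in> carrier_mat n n"
    "(fls_X_intpow N * fps_to_fls t) \<cdot>\<^sub>m A = ?M B" "B * fps.conj_mat B = fps_X ^ d \<cdot>\<^sub>m 1\<^sub>m n"
    by (rule normalize_square[OF A n c(2) \<open>c \<noteq> 0\<close>])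
  from antidiag_normal_form[OF B(2,4)]
  obtain \<nu> where \<nu>: "\<forall>i j. i \<le> j \<longrightarrow> j < n \<longrightarrow> \<nu> j \<le> \<nu> i" "fps.tweq n B (antidiag n \<nu>)"
    by (elim exE conjE) (rule that)
  obtain g where g: "g \<in> carrier (GL n)" "B * fps.conj_mat g = g * antidiag n \<nu>"
    using \<nu>(2) by (auto simp: fps.tweq_def)
  note gc = GL_carrier_mat[OF g(1)]
  define e where "e = fls_X_intpow N * fps_to_fls t"
  let ?\<nu> = "\<lambda>i. int (\<nu> i)" and ?cg = "fps.conj_mat g"
  have cg: "?cg \<in> carrier (GL n)" by (rule fps.conj_mat_GL[OF g(1)])
  have "?M B * ?M ?cg = ?M g * ?M (antidiag n \<nu>)"
    using fps_to_fls.mat_hom_mult[OF B(2) GL_carrier_mat[OF cg]]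
      fps_to_fls.mat_hom_mult[OF gc antidiag_carrier, of \<nu>] g(2) by simp
  then have eq: "(e \<cdot>\<^sub>m A) * ?M ?cg = ?M g * (?D ?\<nu> * ?M ?W)"
    unfolding e_def B(3) fps_to_fls_antidiag[of n \<nu>] .
  interpret GL: group "GL n :: 'a fps mat monoid" by (rule group_GL)
  from GL.l_inv_ex[OF g(1)] obtain h where h: "h \<in> carrier (GL n)" "h * g = 1\<^sub>m n"
    unfolding mult_GL one_GL by (elim bexE) (rule that)
  define X where "X = K2 * ?cg"
  have X: "X \<in> carrier (GL n)" unfolding X_def by (rule GL_mult[OF K(2) cg])
  from GL.r_inv_ex[OF X] obtain X' where X': "X' \<in> carrier (GL n)" "X * X' = 1\<^sub>m n"
    unfolding mult_GL one_GL by (elim bexE) (rule that)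
  note carr [simp] = GL_carrier_mat[OF K(1)] GL_carrier_mat[OF K(2)] gc GL_carrier_mat[OF cg]
    GL_carrier_mat[OF h(1)] GL_carrier_mat[OF X] GL_carrier_mat[OF X'(1)]
    mult_carrier_mat[where nr = n and n = n and nc = n]
  note assoc = assoc_mult_mat[where n\<^sub>1 = n and n\<^sub>2 = n and n\<^sub>3 = n and n\<^sub>4 = n]
  note hom = fps_to_fls.mat_hom_mult[where nr = n and n = n and nc = n]
  have hg: "?M h * ?M g = 1\<^sub>m n"
    using hom[of h g] h(2) by (simp add: fps_to_fls.mat_hom_one)
  have cancel: "?M h * (?M g * Z) = Z" if "Z \<in> carrier_mat n n" for Z
    using assoc[of "?M h" "?M g" Z] hg that by simp
  \<comment> \<open>Multiplying \<open>eq\<close> by \<open>h\<close> on the left and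
    \<open>X'\<close> on the right cancels \<open>g\<close> and \<open>K2 * ?cg\<close>. The two
    sides then exhibit one matrix with Cartan exponents \<mu>, up to the scalar \<open>e\<close>,
    and with exponents \<nu>.\<close>
  have "?M h * ((e \<cdot>\<^sub>m A) * ?M ?cg) * ?M X' = ?D ?\<nu> * ?M ?W * ?M X'"
    unfolding eq by (subst cancel) simp_all
  also have "?M h * ((e \<cdot>\<^sub>m A) * ?M ?cg) * ?M X' = e \<cdot>\<^sub>m (?M h * (A * ?M ?cg) * ?M X')"
    using Ac by (simp add: mult_smult_assoc_mat[of _ n n _ n] mult_smult_distrib[of _ n n _ n])
  also have "?M h * (A * ?M ?cg) * ?M X' = (?M h * ?M K1) * ?D \<mu> * ((?M K2 * ?M ?cg) * ?M X')"
    unfolding A_def by (simp add: assoc)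
  also have "\<dots> = ?M (h * K1) * ?D \<mu>"
    by (simp add: X'(2) fps_to_fls.mat_hom_one right_mult_one_mat[of _ n n] flip: hom X_def)
  also have "?D ?\<nu> * ?M ?W * ?M X' = ?D ?\<nu> * ?M (?W * X')"
    by (simp add: hom assoc)
  finally have main: "e \<cdot>\<^sub>m (?M (h * K1) * ?D \<mu>) = ?D ?\<nu> * ?M (?W * X')" .
  \<comment> \<open>The scalar \<open>e\<close> is divided up: its unit \<open>t\<close> goes into
    the integral factor \<open>Q\<close>, its power of \<pi> into a shift of \<mu> by
    \<open>N\<close>.\<close>
  define Q where "Q = t \<cdot>\<^sub>m (h * K1)"
  have hK: "h * K1 \<in> carrier (GL n)" by (rule GL_mult[OF h(1) K(1)])
  note hKc = GL_carrier_mat[OF hK]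
  have P: "?W * X' \<in> carrier (GL n)" by (rule GL_mult[OF antidiag_GL X'(1)])
  have tunit: "t dvd 1" using B(1) by simp
  have Q: "Q \<in> carrier (GL n)"
    using hK tunit hKc unfolding Q_def
    by (subst GL_iff_det) (auto simp: GL_iff_det[OF hKc] dest!: fps_is_unit_iff[THEN iffD1])
  have entry: "?M Z $$ (i, j) = fps_to_fls (Z $$ (i, j))" if "Z \<in> carrier_mat n n" "i < n" "j < n" for Z i j
    using that by simp
  have "?\<nu> k = \<mu> k + N" if "k < n" for k
  proof (rule cartan_unique[OF P Q _ _ _ that])
    show "dominant n ?\<nu>" using \<nu>(1) by (simp add: dominant_def)
    show "dominant n (\<lambda>i. \<mu> i + N)" using \<mu> by (simp add: dominant_shift)
    fix i j assume ij: "i < n" "j < n"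
    have "fls_X_intpow (?\<nu> i) * fps_to_fls ((?W * X') $$ (i, j)) = (?D ?\<nu> * ?M (?W * X')) $$ (i, j)"
      using ij GL_carrier_mat[OF P] entry[OF GL_carrier_mat[OF P] ij]
      by (subst mat_diag_mult_left[of _ n n]) (simp_all del: index_mult_mat)
    also have "\<dots> = e * (fps_to_fls ((h * K1) $$ (i, j)) * fls_X_intpow (\<mu> j))"
      unfolding main[symmetric]
      using ij hKc entry[OF hKc ij]
      by (subst mat_diag_mult_right[of _ n n]) (simp_all del: index_mult_mat)
    also have "\<dots> = (fls_X_intpow (\<mu> j) * fls_X_intpow N) * fps_to_fls (t * (h * K1) $$ (i, j))"
      unfolding e_def fls_times_fps_to_fls by (simp only: ac_simps)
    also have "\<dots> = fls_X_intpow (\<mu> j + N) * fps_to_fls (Q $$ (i, j))"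
      unfolding Q_def using ij carrier_matD[OF hKc]
      by (simp only: fls_X_intpow_times_fls_X_intpow index_smult_mat)
    finally show "fls_X_intpow (?\<nu> i) * fps_to_fls ((?W * X') $$ (i, j))
        = fls_X_intpow (\<mu> j + N) * fps_to_fls (Q $$ (i, j))" .
  qed
  then have \<nu>\<mu>: "pgl_class n (?D ?\<nu>) = pi_pow n \<mu>"
    unfolding pi_pow_shift[of n \<mu> N, symmetric] pi_pow_def[symmetric] by (rule pi_pow_cong)
  have "e dvd 1"
    unfolding e_def
    using mult_dvd_mono[of "fls_X_intpow N :: 'a fls" 1 "fps_to_fls t" 1]
      fps_to_fls.hom_dvd_1[OF tunit] fls_X_intpow_mult_neg(1)[of N, where ?'a = 'a]
    by (metis dvd_triv_left mult_1)
  have "x \<otimes>\<^bsub>PGL n\<^esub> pgl_bar \<sigma> (pgl_class n (?M g)) = pgl_class n (A * ?M ?cg)"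
    using A g(1) cg by (simp add: xA pgl_bar_class fps_to_fls_GL conj_fps_to_fls pgl_class_mult)
  also have "\<dots> = pgl_class n (e \<cdot>\<^sub>m (A * ?M ?cg))"
    using Ac by (intro pgl_class_smult[symmetric] \<open>e dvd 1\<close>) simp
  also have "e \<cdot>\<^sub>m (A * ?M ?cg) = ?M g * (?D ?\<nu> * ?M ?W)"
    unfolding eq[symmetric] using Ac by (simp add: mult_smult_assoc_mat[of _ n n _ n])
  also have "pgl_class n \<dots> = pgl_class n (?M g) \<otimes>\<^bsub>PGL n\<^esub> (pi_pow n \<mu> \<otimes>\<^bsub>PGL n\<^esub> pgl_class n (?M ?W))"
    unfolding \<nu>\<mu>[symmetric]
    using g(1) by (simp add: pgl_class_mult GL_mult fps_to_fls_GL mat_diag_X_GL antidiag_GL)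
  finally show ?thesis
    using g(1) by (auto simp: PGL_int_def)
qed

text \<open>Both elements are twisted conjugates of one \<open>y\<close>, by \<open>a\<close> and by
  \<open>b\<close>, so \<open>a\<close> times the inverse of \<open>b\<close> carries the first to
  the second.\<close>

theorem twisted_conjugate:
  assumes n: "n > 0" and \<mu>: "dominant n \<mu>"
    and x1: "x1 \<in> C_ad (PGL n) (PGL_int n) (pi_pow n \<mu>) \<inter> S_ad (PGL n) (pgl_bar \<sigma>)"
    and x2: "x2 \<in> C_ad (PGL n) (PGL_int n) (pi_pow n \<mu>) \<inter> S_ad (PGL n) (pgl_bar \<sigma>)"
  shows "\<exists>g\<in>PGL_int n. inv\<^bsub>PGL n\<^esub> g \<otimes>\<^bsub>PGL n\<^esub> x1 \<otimes>\<^bsub>PGL n\<^esub> pgl_bar \<sigma> g = x2"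
proof -
  interpret PGL: group "PGL n :: 'a fls mat set monoid" by (rule group_PGL)
  interpret bar: group_hom "PGL n" "PGL n" "pgl_bar \<sigma>" by (rule pgl_bar_hom)
  interpret K: subgroup "PGL_int n" "PGL n" by (rule PGL_int_subgroup)
  define y where "y = pi_pow n \<mu> \<otimes>\<^bsub>PGL n\<^esub> pgl_class n (map_mat fps_to_fls (antidiag n (\<lambda>_. 0)) :: 'a fls mat)"
  have y: "y \<in> carrier (PGL n)"
    by (auto simp: y_def pi_pow_def carrier_PGL pgl_class_mult GL_mult mat_diag_X_GL fps_to_fls_GL antidiag_GL)
  obtain a b where a: "a \<in> PGL_int n" "x1 \<otimes>\<^bsub>PGL n\<^esub> pgl_bar \<sigma> a = a \<otimes>\<^bsub>PGL n\<^esub> y"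
    and b: "b \<in> PGL_int n" "x2 \<otimes>\<^bsub>PGL n\<^esub> pgl_bar \<sigma> b = b \<otimes>\<^bsub>PGL n\<^esub> y"
    using twisted_representative[OF n \<mu> x1] twisted_representative[OF n \<mu> x2] by (auto simp: y_def)
  note [simp] = K.mem_carrier[OF a(1)] K.mem_carrier[OF b(1)] y
  have x: "x1 \<in> carrier (PGL n)" "x2 \<in> carrier (PGL n)" using x1 x2 by (auto simp: S_ad_def)
  note [simp] = x
  have cancel: "inv\<^bsub>PGL n\<^esub> a \<otimes>\<^bsub>PGL n\<^esub> (a \<otimes>\<^bsub>PGL n\<^esub> z) = z" if "z \<in> carrier (PGL n)" for z
    using that by (simp flip: PGL.m_assoc)
  let ?b = "pgl_bar \<sigma>"
  have "inv\<^bsub>PGL n\<^esub> (a \<otimes>\<^bsub>PGL n\<^esub> inv\<^bsub>PGL n\<^esub> b) \<otimes>\<^bsub>PGL n\<^esub> x1 \<otimes>\<^bsub>PGL n\<^esub> ?b (a \<otimes>\<^bsub>PGL n\<^esub> inv\<^bsub>PGL n\<^esub> b)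
      = b \<otimes>\<^bsub>PGL n\<^esub> inv\<^bsub>PGL n\<^esub> a \<otimes>\<^bsub>PGL n\<^esub> (x1 \<otimes>\<^bsub>PGL n\<^esub> ?b a) \<otimes>\<^bsub>PGL n\<^esub> inv\<^bsub>PGL n\<^esub> ?b b"
    by (simp add: PGL.inv_mult_group PGL.m_assoc)
  also have "\<dots> = b \<otimes>\<^bsub>PGL n\<^esub> y \<otimes>\<^bsub>PGL n\<^esub> inv\<^bsub>PGL n\<^esub> ?b b"
    unfolding a(2) by (simp add: PGL.m_assoc cancel)
  also have "\<dots> = (x2 \<otimes>\<^bsub>PGL n\<^esub> ?b b) \<otimes>\<^bsub>PGL n\<^esub> inv\<^bsub>PGL n\<^esub> ?b b"
    unfolding b(2) ..
  also have "\<dots> = x2" by (simp add: PGL.m_assoc)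
  finally show ?thesis
    using a(1) b(1) by blast
qed

end

text \<open>An element of \<open>S_ad\<close> is a pair of mutually inverse components, and
  \<open>g = (g1, g2)\<close> turns its first component \<open>u\<close> into
  \<open>inv g1 * u * g2\<close>. It is enough to match first components inside one double coset of
  \<open>K\<close>; the second ones follow by inversion.\<close>

lemma twisted_conjugate_split:
  assumes G: "group G" and K: "subgroup K G" and t: "t1 \<in> carrier G" "t2 \<in> carrier G"
    and x: "x \<in> C_ad (G \<times>\<times> G) (K \<times> K) (t1, t2) \<inter> S_ad (G \<times>\<times> G) prod.swap"
    and y: "y \<in> C_ad (G \<times>\<times> G) (K \<times> K) (t1, t2) \<inter> S_ad (G \<times>\<times> G) prod.swap"
  shows "\<exists>g\<in>K \<times> K. inv\<^bsub>G \<times>\<times> G\<^esub> g \<otimes>\<^bsub>G \<times>\<times> G\<^esub> x \<otimes>\<^bsub>G \<times>\<times> G\<^esub> prod.swap g = y"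
proof -
  interpret group G by fact
  interpret K: subgroup K G by fact
  have rep: "\<exists>k\<in>K. \<exists>k'\<in>K. z = (k \<otimes>\<^bsub>G\<^esub> t1 \<otimes>\<^bsub>G\<^esub> k', inv\<^bsub>G\<^esub> (k \<otimes>\<^bsub>G\<^esub> t1 \<otimes>\<^bsub>G\<^esub> k'))"
    if "z \<in> C_ad (G \<times>\<times> G) (K \<times> K) (t1, t2) \<inter> S_ad (G \<times>\<times> G) prod.swap" for z
  proof -
    have "z \<in> C_ad (G \<times>\<times> G) (K \<times> K) (t1, t2)" using that by (rule IntD1)
    then obtain p q where pq: "p \<in> K \<times> K" "q \<in> K \<times> K" "z = p \<otimes>\<^bsub>G \<times>\<times> G\<^esub> (t1, t2) \<otimes>\<^bsub>G \<times>\<times> G\<^esub> q"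
      unfolding C_ad_iff by blast
    then have k: "fst p \<in> K" "fst q \<in> K" "fst z = fst p \<otimes>\<^bsub>G\<^esub> t1 \<otimes>\<^bsub>G\<^esub> fst q"
      by (auto simp: mult_DirProd')
    have "fst z \<in> carrier G" "snd z \<in> carrier G" "snd z \<otimes>\<^bsub>G\<^esub> fst z = \<one>\<^bsub>G\<^esub>"
      using that by (cases z; auto simp: S_ad_def)+
    then have "inv\<^bsub>G\<^esub> fst z = snd z" by (intro inv_equality)
    then have "z = (fst z, inv\<^bsub>G\<^esub> fst z)" by (cases z) simp
    with k show ?thesis by metis
  qed
  obtain a a' where a: "a \<in> K" "a' \<in> K"
    "x = (a \<otimes>\<^bsub>G\<^esub> t1 \<otimes>\<^bsub>G\<^esub> a', inv\<^bsub>G\<^esub> (a \<otimes>\<^bsub>G\<^esub> t1 \<otimes>\<^bsub>G\<^esub> a'))"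
    using rep[OF x] by blast
  obtain b b' where b: "b \<in> K" "b' \<in> K"
    "y = (b \<otimes>\<^bsub>G\<^esub> t1 \<otimes>\<^bsub>G\<^esub> b', inv\<^bsub>G\<^esub> (b \<otimes>\<^bsub>G\<^esub> t1 \<otimes>\<^bsub>G\<^esub> b'))"
    using rep[OF y] by blast
  note [simp] = a(1,2) b(1,2) t G
  let ?g = "(a \<otimes>\<^bsub>G\<^esub> inv\<^bsub>G\<^esub> b, inv\<^bsub>G\<^esub> a' \<otimes>\<^bsub>G\<^esub> b')"
  have cancel: "inv\<^bsub>G\<^esub> u \<otimes>\<^bsub>G\<^esub> (u \<otimes>\<^bsub>G\<^esub> v) = v" "u \<otimes>\<^bsub>G\<^esub> (inv\<^bsub>G\<^esub> u \<otimes>\<^bsub>G\<^esub> v) = v"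
    if "u \<in> carrier G" "v \<in> carrier G" for u v
    using that by (simp_all flip: m_assoc)
  have "?g \<in> K \<times> K" by simp
  moreover have "inv\<^bsub>G \<times>\<times> G\<^esub> ?g \<otimes>\<^bsub>G \<times>\<times> G\<^esub> x \<otimes>\<^bsub>G \<times>\<times> G\<^esub> prod.swap ?g = y"
    unfolding a(3) b(3) by (simp add: inv_mult_group m_assoc cancel)
  ultimately show ?thesis by blast
qed

theorem lemma3p4p3:
  fixes n :: nat
  assumes "n \<ge> 1" and "CHAR('k::{field,finite}) > 2 * n"
  shows
    "(\<forall>(\<iota> :: 'k \<Rightarrow> 'l::field) \<sigma> \<mu> x\<^sub>1 x\<^sub>2.
        quadratic_extension \<iota> \<longrightarrow> nontrivial_automorphism \<iota> \<sigma> \<longrightarrow> dominant n \<mu> \<longrightarrow>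
        x\<^sub>1 \<in> C_ad (PGL n) (PGL_int n) (pi_pow n \<mu>) \<inter> S_ad (PGL n) (pgl_bar \<sigma>) \<longrightarrow>
        x\<^sub>2 \<in> C_ad (PGL n) (PGL_int n) (pi_pow n \<mu>) \<inter> S_ad (PGL n) (pgl_bar \<sigma>) \<longrightarrow>
        (\<exists>g\<in>PGL_int n. inv\<^bsub>PGL n\<^esub> g \<otimes>\<^bsub>PGL n\<^esub> x\<^sub>1 \<otimes>\<^bsub>PGL n\<^esub> pgl_bar \<sigma> g = x\<^sub>2))
     \<and>
     (\<forall>\<mu>\<^sub>1 \<mu>\<^sub>2 x\<^sub>1 x\<^sub>2.
        let G = (PGL n :: 'k fls mat set monoid) \<times>\<times> PGL n;
            K = PGL_int n \<times> PGL_int n;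
            C = C_ad G K (pi_pow n \<mu>\<^sub>1, pi_pow n \<mu>\<^sub>2)
        in
        dominant n \<mu>\<^sub>1 \<longrightarrow> dominant n \<mu>\<^sub>2 \<longrightarrow>
        x\<^sub>1 \<in> C \<inter> S_ad G prod.swap \<longrightarrow>
        x\<^sub>2 \<in> C \<inter> S_ad G prod.swap \<longrightarrow>
        (\<exists>g\<in>K. inv\<^bsub>G\<^esub> g \<otimes>\<^bsub>G\<^esub> x\<^sub>1 \<otimes>\<^bsub>G\<^esub> prod.swap g = x\<^sub>2))"
proof (intro conjI allI impI)
  \<comment> \<open>The characteristic exceeds \<open>2 * n \<ge> 2\<close> and so cannot divide
    2.\<close>
  have "(of_nat 2 :: 'k) \<noteq> 0"
    unfolding of_nat_eq_0_iff_char_dvd using assms by (auto dest: dvd_imp_le)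
  then have two: "(2 :: 'k) \<noteq> 0" by simp
  fix \<iota> :: "'k \<Rightarrow> 'l" and \<sigma> \<mu> x\<^sub>1 x\<^sub>2
  assume "quadratic_extension \<iota>" "nontrivial_automorphism \<iota> \<sigma>"
  then interpret finite_field_involution \<sigma>
    by (rule quadratic_extension_involution[OF _ _ two])
  assume "dominant n \<mu>"
    "x\<^sub>1 \<in> C_ad (PGL n) (PGL_int n) (pi_pow n \<mu>) \<inter> S_ad (PGL n) (pgl_bar \<sigma>)"
    "x\<^sub>2 \<in> C_ad (PGL n) (PGL_int n) (pi_pow n \<mu>) \<inter> S_ad (PGL n) (pgl_bar \<sigma>)"
  then show "\<exists>g\<in>PGL_int n. inv\<^bsub>PGL n\<^esub> g \<otimes>\<^bsub>PGL n\<^esub> x\<^sub>1 \<otimes>\<^bsub>PGL n\<^esub> pgl_bar \<sigma> g = x\<^sub>2"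
    using assms(1) by (intro twisted_conjugate) auto
next
  fix \<mu>\<^sub>1 \<mu>\<^sub>2 and x\<^sub>1 x\<^sub>2 :: "'k fls mat set \<times> 'k fls mat set"
  have "pi_pow n \<mu> \<in> carrier (PGL n :: 'k fls mat set monoid)" for \<mu>
    unfolding pi_pow_def carrier_PGL by (intro imageI mat_diag_X_GL)
  note split = twisted_conjugate_split[OF group_PGL PGL_int_subgroup this this]
  show "let G = (PGL n :: 'k fls mat set monoid) \<times>\<times> PGL n;
            K = PGL_int n \<times> PGL_int n;
            C = C_ad G K (pi_pow n \<mu>\<^sub>1, pi_pow n \<mu>\<^sub>2)
        in
        dominant n \<mu>\<^sub>1 \<longrightarrow> dominant n \<mu>\<^sub>2 \<longrightarrow>
        x\<^sub>1 \<in> C \<inter> S_ad G prod.swap \<longrightarrow>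
        x\<^sub>2 \<in> C \<inter> S_ad G prod.swap \<longrightarrow>
        (\<exists>g\<in>K. inv\<^bsub>G\<^esub> g \<otimes>\<^bsub>G\<^esub> x\<^sub>1 \<otimes>\<^bsub>G\<^esub> prod.swap g = x\<^sub>2)"
    unfolding Let_def by (intro impI split)
qed

end
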